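(* Let $(s_n:-\infty<n<\infty)$ be an independent and identically distributed (iid) sequence of positive random variables, independent of an iid sequence $(t_n:-\infty<n<\infty)$ of positive random variables. Let $F(x)=\mathbf P(s_1\le x)$, $\bar F(x)=\mathbf P(s_1>x)$, $T_n=\sum_{k=1}^n t_k$ and $\widetilde T_n=\sum_{k=1}^n t_{-k}$ for $n\ge 0$, and $$\widetilde X_\infty=\max\Big(0,\ \sup_{j\ge 1}\big[s_{-j}-\widetilde T_{j-1}\big]\Big).$$ Let $X=(X_n:n\ge 0)$ be the Markov chain defined by $X_{n+1}=\max(X_n-t_{n+1},s_{n+1})$, $n\ge 0$, with $X_0$ independent of $((s_j,t_j):j\ge1)$. Fix $m_0\ge 1$ and $w_0<\infty$ such that $\mathbf P(s_1\le w_0)\ge 1/2$ and $\mathbf P(T_{m_0}>w_0)\ge 1/2$. Then: a) For $y\ge 0$, if $\sum_{n=1}^\infty\mathbf E\prod_{i=1}^nF(y+\widetilde T_i)<\infty$, then for every $x\in\mathbb R_+$, $$\mathbf E_x\sum_{n=0}^\infty I(X_n\le y)<\infty.$$ b) If $\sum_{n=1}^\infty\mathbf E\prod_{i=0}^{n-1}F(w_0+\widetilde T_i)=\infty$, then $X$ is a Harris recurrent Markov chain on $\mathbb R_+$. c) $\mathbf P\big(\sum_{i=1}^\infty\bar F(\widetilde T_i)<\infty\big)=1$ if and only if $X$ is a positive recurrent Harris chain on $\mathbb R_+$ with stationary distribution $\pi$ given by $\pi(\cdot)=\mathbf P(\widetilde X_\infty\in\cdot)$.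
   Context: $\mathbb R_+=[0,\infty)$; $I(\cdot)$ is the indicator; $\mathbf P_x$, $\mathbf E_x$ denote probability and expectation given $X_0=x$; empty sums are $0$. A Markov chain on $\mathbb R_+$ is Harris recurrent if there is a nonzero $\sigma$-finite measure $\psi$ on $\mathbb R_+$ such that $\psi(B)>0$ implies $\mathbf P_x(X_n\in B\text{ infinitely often})=1$ for every $x\in\mathbb R_+$; it is positive recurrent Harris if in addition it has a stationary probability distribution. *)

theory Defs
  imports "HOL-Probability.Probability"
begin

definition iid_sequence :: "'a measure \<Rightarrow> (int \<Rightarrow> 'a \<Rightarrow> real) \<Rightarrow> bool" where
  "iid_sequence M Z \<longleftrightarrow>
     prob_space.indep_vars M (\<lambda>_. borel) Z UNIV \<and>
     (\<forall>m n. distr M borel (Z m) = distr M borel (Z n))"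

definition independent_sequences ::
    "'a measure \<Rightarrow> (int \<Rightarrow> 'a \<Rightarrow> real) \<Rightarrow> (int \<Rightarrow> 'a \<Rightarrow> real) \<Rightarrow> bool" where
  "independent_sequences M Y Z \<longleftrightarrow>
     prob_space.indep_var M
       (Pi\<^sub>M UNIV (\<lambda>_. borel)) (\<lambda>\<omega> n. Y n \<omega>)
       (Pi\<^sub>M UNIV (\<lambda>_. borel)) (\<lambda>\<omega> n. Z n \<omega>)"


subsection \<open>Markov chains on a Borel set of reals\<close>

text \<open>
  A time-homogeneous Markov chain on a state space \<open>S\<close> is represented by the family of its path
  laws: \<open>P x\<close> is the law on \<open>nat \<Rightarrow> real\<close> of the whole trajectory, given that it starts in \<open>x\<close>.
\<close>

abbreviation path_space :: "(nat \<Rightarrow> real) measure" where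
  "path_space \<equiv> Pi\<^sub>M UNIV (\<lambda>_. borel)"

definition transition :: "(real \<Rightarrow> (nat \<Rightarrow> real) measure) \<Rightarrow> real \<Rightarrow> real set \<Rightarrow> ennreal" where
  "transition P x B = emeasure (P x) {\<xi> \<in> space (P x). \<xi> 1 \<in> B}"

text \<open>
  The paths are only required to stay in \<open>S\<close> almost surely. The last conjunct is the Markov
  property: given \<open>\<xi> 0, \<dots>, \<xi> n\<close>, the next state is distributed according to
  \<open>transition P (\<xi> n)\<close>.
\<close>

definition markov_chain_on :: "real set \<Rightarrow> (real \<Rightarrow> (nat \<Rightarrow> real) measure) \<Rightarrow> bool" where
  "markov_chain_on S P \<longleftrightarrow>
     (\<forall>x\<in>S. prob_space (P x) \<and> sets (P x) = sets path_space \<and>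
        (AE \<xi> in P x. \<xi> 0 = x) \<and> (AE \<xi> in P x. \<forall>n. \<xi> n \<in> S)) \<and>
     (\<forall>B\<in>sets borel. (\<lambda>x. transition P x B) \<in> borel_measurable (restrict_space borel S)) \<and>
     (\<forall>x\<in>S. \<forall>n. \<forall>A\<in>sets (Pi\<^sub>M {..n} (\<lambda>_. borel)). \<forall>B\<in>sets borel.
        emeasure (P x) {\<xi> \<in> space (P x). restrict \<xi> {..n} \<in> A \<and> \<xi> (Suc n) \<in> B} =
        (\<integral>\<^sup>+\<xi>. indicator A (restrict \<xi> {..n}) * transition P (\<xi> n) B \<partial>P x))"

definition harris_recurrent :: "real set \<Rightarrow> (real \<Rightarrow> (nat \<Rightarrow> real) measure) \<Rightarrow> bool" where
  "harris_recurrent S P \<longleftrightarrow>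
     markov_chain_on S P \<and>
     (\<exists>\<psi>. sets \<psi> = sets (restrict_space borel S) \<and> sigma_finite_measure \<psi> \<and>
        emeasure \<psi> S \<noteq> 0 \<and>
        (\<forall>B\<in>sets \<psi>. emeasure \<psi> B > 0 \<longrightarrow>
           (\<forall>x\<in>S. \<P>(\<xi> in P x. \<exists>\<^sub>\<infinity>n. \<xi> n \<in> B) = 1)))"

definition stationary_distribution ::
    "real set \<Rightarrow> (real \<Rightarrow> (nat \<Rightarrow> real) measure) \<Rightarrow> real measure \<Rightarrow> bool" where
  "stationary_distribution S P \<pi> \<longleftrightarrow>
     prob_space \<pi> \<and> sets \<pi> = sets (restrict_space borel S) \<and>
     (\<forall>B\<in>sets \<pi>. emeasure \<pi> B = (\<integral>\<^sup>+x. transition P x B \<partial>\<pi>))"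

definition positive_harris_recurrent :: "real set \<Rightarrow> (real \<Rightarrow> (nat \<Rightarrow> real) measure) \<Rightarrow> bool" where
  "positive_harris_recurrent S P \<longleftrightarrow>
     harris_recurrent S P \<and> (\<exists>\<pi>. stationary_distribution S P \<pi>)"


subsection \<open>The chain driven by the two sequences\<close>

definition fwd_sum :: "(int \<Rightarrow> 'a \<Rightarrow> real) \<Rightarrow> nat \<Rightarrow> 'a \<Rightarrow> real" where
  "fwd_sum t n \<omega> = (\<Sum>k=1..n. t (int k) \<omega>)"

definition bwd_sum :: "(int \<Rightarrow> 'a \<Rightarrow> real) \<Rightarrow> nat \<Rightarrow> 'a \<Rightarrow> real" where
  "bwd_sum t n \<omega> = (\<Sum>k=1..n. t (- int k) \<omega>)"

definition F_dist :: "'a measure \<Rightarrow> (int \<Rightarrow> 'a \<Rightarrow> real) \<Rightarrow> real \<Rightarrow> real" where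
  "F_dist M s x = \<P>(\<omega> in M. s 1 \<omega> \<le> x)"

definition F_tail :: "'a measure \<Rightarrow> (int \<Rightarrow> 'a \<Rightarrow> real) \<Rightarrow> real \<Rightarrow> real" where
  "F_tail M s x = \<P>(\<omega> in M. s 1 \<omega> > x)"

text \<open>The supremum may be infinite, hence the extended real values.\<close>

definition X_inf :: "(int \<Rightarrow> 'a \<Rightarrow> real) \<Rightarrow> (int \<Rightarrow> 'a \<Rightarrow> real) \<Rightarrow> 'a \<Rightarrow> ereal" where
  "X_inf s t \<omega> = max 0 (SUP j\<in>{1..}. ereal (s (- int j) \<omega> - bwd_sum t (j - 1) \<omega>))"

primrec chain ::
    "(int \<Rightarrow> 'a \<Rightarrow> real) \<Rightarrow> (int \<Rightarrow> 'a \<Rightarrow> real) \<Rightarrow> real \<Rightarrow> nat \<Rightarrow> 'a \<Rightarrow> real" where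
  "chain s t x 0 \<omega> = x"
| "chain s t x (Suc n) \<omega> = max (chain s t x n \<omega> - t (int (Suc n)) \<omega>) (s (int (Suc n)) \<omega>)"

text \<open>
  The initial state is independent of the driving variables with positive index, so conditioning
  on its value being \<open>x\<close> amounts to running the recursion from the constant \<open>x\<close>.
\<close>

definition chain_law ::
    "'a measure \<Rightarrow> (int \<Rightarrow> 'a \<Rightarrow> real) \<Rightarrow> (int \<Rightarrow> 'a \<Rightarrow> real) \<Rightarrow> real \<Rightarrow> (nat \<Rightarrow> real) measure" where
  "chain_law M s t x = distr M path_space (\<lambda>\<omega> n. chain s t x n \<omega>)"

end

theory Submission
  imports Defs
begin

text \<open>
  All chains \<open>X\<close> driven by the same sequences are monotone in the starting point, and the chain from \<open>x\<close>
  agrees with the chain from 0 as soon as \<open>T\<^sub>n \<ge> x\<close>; so only the chain from 0 matters for recurrence.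
  Reversing the time of the first \<open>n\<close> driving pairs, \<open>X\<^sub>n \<le> y\<close> turns into the event that
  \<open>s\<^sub>j \<le> y + T\<^sub>j\<close> for all \<open>j < n\<close> (indices from 0), whose probability is the expected product of
  distribution functions; this gives part a). If these probabilities have a divergent sum, visits to
  \<open>[0, y]\<close> followed by a block of \<open>m\<close> steps with total decrement above \<open>y\<close> regenerate the chain, and a
  renewal counting argument shows that every event of positive probability under such a block
  recurs almost surely; this gives part b) with no 0-1 law. For part c), the reversed events decrease
  to \<open>X\<^sub>\<infinity> \<le> y\<close>, and the product \<open>\<Prod>F(y + T\<^sub>j)\<close> is squeezed between \<open>1 - \<Sum>(1 - F(y + T\<^sub>j))\<close>
  and \<open>exp (- \<Sum>(1 - F(y + T\<^sub>j)))\<close>; stationarity holds because prepending one driving pair \<open>(a, b)\<close>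
  maps \<open>X\<^sub>\<infinity>\<close> to \<open>max (X\<^sub>\<infinity> - b) a\<close>.
\<close>

section \<open>The recursion along a fixed driving sequence\<close>

primrec orbit :: "real \<Rightarrow> (nat \<Rightarrow> real \<times> real) \<Rightarrow> nat \<Rightarrow> real" where
  "orbit x z 0 = x"
| "orbit x z (Suc n) = max (orbit x z n - snd (z n)) (fst (z n))"

definition psum :: "(nat \<Rightarrow> real \<times> real) \<Rightarrow> nat \<Rightarrow> real" where
  "psum z n = (\<Sum>k<n. snd (z k))"

text \<open>For \<open>y \<ge> 0\<close> this is the finite-horizon form of the event that the
  all-time maximum \<open>Xi z\<close> is at most \<open>y\<close>; the index 0 comes with no
  decrement.\<close>

definition below :: "nat \<Rightarrow> real \<Rightarrow> (nat \<Rightarrow> real \<times> real) \<Rightarrow> bool" where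
  "below n y z \<longleftrightarrow> (\<forall>j<n. fst (z j) \<le> y + psum z j)"

definition shift :: "nat \<Rightarrow> (nat \<Rightarrow> 'b) \<Rightarrow> nat \<Rightarrow> 'b" where
  "shift n z = (\<lambda>k. z (n + k))"

definition positive_seq :: "(nat \<Rightarrow> real \<times> real) \<Rightarrow> bool" where
  "positive_seq z \<longleftrightarrow> (\<forall>k. 0 < fst (z k) \<and> 0 < snd (z k))"

lemma orbit_cong: "(\<And>k. k < n \<Longrightarrow> z k = z' k) \<Longrightarrow> orbit x z n = orbit x z' n"
  by (induction n) simp_all

lemma psum_cong: "(\<And>k. k < n \<Longrightarrow> z k = z' k) \<Longrightarrow> psum z n = psum z' n"
  by (simp add: psum_def)

lemma below_cong: "(\<And>k. k < n \<Longrightarrow> z k = z' k) \<Longrightarrow> below n y z = below n y z'"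
  unfolding below_def by (auto cong: psum_cong)

lemma orbit_comb_seq: "k \<le> n \<Longrightarrow> orbit x (comb_seq n u v) k = orbit x u k"
  by (rule orbit_cong) (simp add: comb_seq_less)

lemma psum_comb_seq: "k \<le> n \<Longrightarrow> psum (comb_seq n u v) k = psum u k"
  by (rule psum_cong) (simp add: comb_seq_less)

lemma shift_comb_seq [simp]: "shift n (comb_seq n u v) = v"
  by (simp add: shift_def comb_seq_def)

lemma shift_comb_seq_add: "shift n (comb_seq (n + m) u v) = comb_seq m (shift n u) v"
  by (auto simp: shift_def comb_seq_def)

lemma shift_shift: "shift n (shift m z) = shift (m + n) z"
  by (simp add: shift_def add.assoc)

lemma orbit_add: "orbit x z (m + n) = orbit (orbit x z m) (shift m z) n"
  by (induction n) (simp_all add: shift_def)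

lemma psum_0 [simp]: "psum z 0 = 0"
  by (simp add: psum_def)

lemma psum_Suc: "psum z (Suc n) = psum z n + snd (z n)"
  by (simp add: psum_def)

lemma psum_add: "psum z (m + n) = psum z m + psum (shift m z) n"
  by (induction n) (simp_all add: psum_Suc shift_def)

lemma psum_case_nat [simp]: "psum (case_nat a z) (Suc n) = snd a + psum z n"
  unfolding psum_def by (subst sum.lessThan_Suc_shift) simp

text \<open>Peeling off the first pair raises the level by its decrement; every later induction on
  \<open>below\<close> rests on this.\<close>

lemma below_Suc: "below (Suc n) y z \<longleftrightarrow> fst (z 0) \<le> y \<and> below n (y + snd (z 0)) (shift 1 z)"
proof -
  have "psum z (Suc j) = snd (z 0) + psum (shift 1 z) j" for j
    using psum_add[of z 1 j] by (simp add: psum_Suc)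
  then show ?thesis
    by (simp add: below_def All_less_Suc2 add.assoc shift_def)
qed

lemma orbit_mono: "x \<le> x' \<Longrightarrow> orbit x z n \<le> orbit x' z n"
  by (induction n) auto

text \<open>The recursion is max-plus linear, so the starting point survives only through the term
  \<open>x - psum z n\<close>.\<close>

lemma orbit_eq_max: "x' \<le> x \<Longrightarrow> orbit x z n = max (x - psum z n) (orbit x' z n)"
  by (induction n) (auto simp: psum_Suc max_def)

lemma orbit_nonneg: "positive_seq z \<Longrightarrow> 0 \<le> x \<Longrightarrow> 0 \<le> orbit x z n"
  by (cases n) (auto simp: positive_seq_def le_max_iff_disj less_imp_le)

lemma psum_mono: "positive_seq z \<Longrightarrow> m \<le> n \<Longrightarrow> psum z m \<le> psum z n"
  unfolding psum_def positive_seq_def by (intro sum_mono2) (auto simp: less_imp_le)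

lemma psum_nonneg: "positive_seq z \<Longrightarrow> 0 \<le> psum z n"
  using psum_mono[of z 0 n] by simp

lemma positive_seq_shift: "positive_seq z \<Longrightarrow> positive_seq (shift m z)"
  by (simp add: positive_seq_def shift_def)

text \<open>Once the total decrement reaches \<open>x\<close>, the term remembering \<open>x\<close>
  is at most 0 and is absorbed by the nonnegative chain from 0.\<close>

lemma orbit_coalesce: "positive_seq z \<Longrightarrow> 0 \<le> x \<Longrightarrow> x \<le> psum z n \<Longrightarrow> orbit x z n = orbit 0 z n"
  using orbit_eq_max[of 0 x z n] orbit_nonneg[of z 0 n] by simp

lemma orbit_shift_le:
  "positive_seq z \<Longrightarrow> orbit 0 (shift m z) n \<le> orbit 0 z (m + n)"
  unfolding orbit_add by (intro orbit_mono orbit_nonneg) auto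

text \<open>Pathwise time reversal: unrolling from the last step, each step back raises the
  admissible level by the decrement just passed, so the pairs enter \<open>below\<close> in reverse
  order.\<close>

lemma orbit_le_iff:
  "orbit x z n \<le> y \<longleftrightarrow> x \<le> y + psum z n \<and> below n y (\<lambda>k. z (n - Suc k))"
proof (induction n arbitrary: y)
  case (Suc n)
  have "orbit x z (Suc n) \<le> y \<longleftrightarrow> orbit x z n \<le> y + snd (z n) \<and> fst (z n) \<le> y"
    by auto
  also have "\<dots> \<longleftrightarrow> x \<le> y + psum z (Suc n) \<and> below (Suc n) y (\<lambda>k. z (Suc n - Suc k))"
    unfolding Suc.IH below_Suc psum_Suc by (auto simp: algebra_simps shift_def)
  finally show ?case .
qed (simp add: below_def)

section \<open>Measurability of functionals of the driving sequence\<close>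

abbreviation seq_space :: "(nat \<Rightarrow> real \<times> real) measure" where
  "seq_space \<equiv> \<Pi>\<^sub>M i\<in>UNIV. borel \<Otimes>\<^sub>M borel"

lemma measurable_seq_component [measurable (raw)]:
  "f \<in> N \<rightarrow>\<^sub>M seq_space \<Longrightarrow> (\<lambda>x. f x k) \<in> N \<rightarrow>\<^sub>M borel \<Otimes>\<^sub>M borel"
  by (rule measurable_compose[OF _ measurable_component_singleton]) auto

lemma measurable_orbit [measurable (raw)]:
  assumes [measurable]: "f \<in> N \<rightarrow>\<^sub>M seq_space" "g \<in> borel_measurable N"
  shows "(\<lambda>x. orbit (g x) (f x) n) \<in> borel_measurable N"
  by (induction n) simp_all

lemma measurable_psum [measurable (raw)]:
  assumes [measurable]: "f \<in> N \<rightarrow>\<^sub>M seq_space"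
  shows "(\<lambda>x. psum (f x) n) \<in> borel_measurable N"
  unfolding psum_def by measurable

lemma measurable_shift [measurable (raw)]:
  assumes f: "f \<in> N \<rightarrow>\<^sub>M seq_space"
  shows "(\<lambda>x. shift n (f x)) \<in> N \<rightarrow>\<^sub>M seq_space"
  unfolding shift_def
  by (rule measurable_PiM_single')
     (auto intro: measurable_seq_component[OF f] simp: space_pair_measure)

lemma pred_below [measurable (raw)]:
  assumes [measurable]: "f \<in> N \<rightarrow>\<^sub>M seq_space" "g \<in> borel_measurable N"
  shows "Measurable.pred N (\<lambda>x. below n (g x) (f x))"
  unfolding below_def by measurable

lemma pred_positive_seq [measurable (raw)]:
  assumes [measurable]: "f \<in> N \<rightarrow>\<^sub>M seq_space"
  shows "Measurable.pred N (\<lambda>x. positive_seq (f x))"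
  unfolding positive_seq_def by measurable

section \<open>The canonical space of iid driving pairs\<close>

locale driving_laws =
  \<mu>: prob_space \<mu> + \<nu>: prob_space \<nu> for \<mu> \<nu> :: "real measure" +
  assumes sets_\<mu> [measurable_cong]: "sets \<mu> = sets borel"
    and sets_\<nu> [measurable_cong]: "sets \<nu> = sets borel"
    and \<mu>_pos: "AE a in \<mu>. 0 < a" and \<nu>_pos: "AE b in \<nu>. 0 < b"
begin

sublocale \<kappa>: pair_prob_space \<mu> \<nu> ..

sublocale sequence_space "\<mu> \<Otimes>\<^sub>M \<nu>" ..

abbreviation Q :: "(nat \<Rightarrow> real \<times> real) measure" where
  "Q \<equiv> \<Pi>\<^sub>M i\<in>UNIV. \<mu> \<Otimes>\<^sub>M \<nu>"

lemma space_\<mu> [simp]: "space \<mu> = UNIV" and space_\<nu> [simp]: "space \<nu> = UNIV"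
  using sets_eq_imp_space_eq[OF sets_\<mu>] sets_eq_imp_space_eq[OF sets_\<nu>] by simp_all

lemma space_Q [simp]: "space Q = UNIV"
  by (simp add: space_PiM space_pair_measure)

lemma sets_QI: "Measurable.pred Q P \<Longrightarrow> {z. P z} \<in> sets Q"
  by (drule predE) simp

lemma AE_positive_seq: "AE z in Q. positive_seq z"
proof -
  have "AE p in \<mu> \<Otimes>\<^sub>M \<nu>. 0 < fst p \<and> 0 < snd p"
    using \<mu>_pos \<nu>_pos
    by (subst \<kappa>.AE_pair_iff[symmetric]) auto
  then show ?thesis
    unfolding positive_seq_def by (intro AE_all_countable[THEN iffD2] allI AE_component) auto
qed

text \<open>Independence of past and future at time \<open>n\<close>: the first \<open>n\<close>
  pairs may be taken from \<open>u\<close> and the rest from an independent copy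
  \<open>v\<close>.\<close>

lemma nn_integral_comb_seq:
  assumes [measurable]: "f \<in> borel_measurable Q"
  shows "(\<integral>\<^sup>+z. f z \<partial>Q) = (\<integral>\<^sup>+u. \<integral>\<^sup>+v. f (comb_seq n u v) \<partial>Q \<partial>Q)"
proof -
  have "(\<integral>\<^sup>+z. f z \<partial>Q) = (\<integral>\<^sup>+z. f z \<partial>distr (Q \<Otimes>\<^sub>M Q) Q (\<lambda>(\<omega>, \<omega>'). comb_seq n \<omega> \<omega>'))"
    by (simp only: PiM_comb_seq)
  also have "\<dots> = (\<integral>\<^sup>+p. f (case p of (\<omega>, \<omega>') \<Rightarrow> comb_seq n \<omega> \<omega>') \<partial>(Q \<Otimes>\<^sub>M Q))"
    by (rule nn_integral_distr) measurable
  also have "\<dots> = (\<integral>\<^sup>+u. \<integral>\<^sup>+v. f (comb_seq n u v) \<partial>Q \<partial>Q)"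
    by (subst P.nn_integral_fst[symmetric]) auto
  finally show ?thesis .
qed

lemma nn_integral_case_nat:
  assumes [measurable]: "f \<in> borel_measurable Q"
  shows "(\<integral>\<^sup>+z. f z \<partial>Q) = (\<integral>\<^sup>+a. \<integral>\<^sup>+b. \<integral>\<^sup>+z. f (case_nat (a, b) z) \<partial>Q \<partial>\<nu> \<partial>\<mu>)"
proof -
  have "(\<integral>\<^sup>+z. f z \<partial>Q) = (\<integral>\<^sup>+z. f z \<partial>distr ((\<mu> \<Otimes>\<^sub>M \<nu>) \<Otimes>\<^sub>M Q) Q (\<lambda>(s, \<omega>). case_nat s \<omega>))"
    by (simp only: PiM_iter)
  also have "\<dots> = (\<integral>\<^sup>+p. f (case p of (s, \<omega>) \<Rightarrow> case_nat s \<omega>) \<partial>((\<mu> \<Otimes>\<^sub>M \<nu>) \<Otimes>\<^sub>M Q))"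
    by (rule nn_integral_distr) measurable
  also have "\<dots> = (\<integral>\<^sup>+p. \<integral>\<^sup>+z. f (case_nat p z) \<partial>Q \<partial>(\<mu> \<Otimes>\<^sub>M \<nu>))"
    by (subst P.nn_integral_fst[symmetric]) auto
  also have "\<dots> = (\<integral>\<^sup>+a. \<integral>\<^sup>+b. \<integral>\<^sup>+z. f (case_nat (a, b) z) \<partial>Q \<partial>\<nu> \<partial>\<mu>)"
    by (subst \<nu>.nn_integral_fst[symmetric]) auto
  finally show ?thesis .
qed

text \<open>The last hypothesis says that \<open>A\<close> reads only the first \<open>n\<close>
  pairs, whereas \<open>B (shift n z)\<close> reads only the later ones, so the two events are
  independent.\<close>

lemma emeasure_conj_shift:
  assumes [measurable]: "Measurable.pred Q A" "Measurable.pred Q B"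
    and A: "\<And>u v. A (comb_seq n u v) = A u"
  shows "emeasure Q {z. A z \<and> B (shift n z)} = emeasure Q {z. A z} * emeasure Q {z. B z}"
proof -
  have ms: "{z. A z} \<in> sets Q" "{z. B z} \<in> sets Q" "{z. A z \<and> B (shift n z)} \<in> sets Q"
    by (intro sets_QI; measurable)+
  have "emeasure Q {z. A z \<and> B (shift n z)} = (\<integral>\<^sup>+z. indicator {z. A z \<and> B (shift n z)} z \<partial>Q)"
    using ms by simp
  also have "\<dots> = (\<integral>\<^sup>+u. \<integral>\<^sup>+v. indicator {z. A z} u * indicator {z. B z} v \<partial>Q \<partial>Q)"
    using ms by (subst nn_integral_comb_seq[of _ n])
       (auto simp: A indicator_def intro!: nn_integral_cong)
  also have "\<dots> = emeasure Q {z. A z} * emeasure Q {z. B z}"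
    using ms by (simp add: nn_integral_cmult nn_integral_multc)
  finally show ?thesis .
qed

section \<open>The product formula\<close>

definition F :: "real \<Rightarrow> real" where "F x = measure \<mu> {..x}"

lemma F_nonneg: "0 \<le> F x" and F_le_1: "F x \<le> 1"
  by (simp_all add: F_def)

lemma F_mono: "x \<le> y \<Longrightarrow> F x \<le> F y"
  unfolding F_def by (intro \<mu>.finite_measure_mono) (auto simp: sets_\<mu>)

lemma measurable_F [measurable]: "F \<in> borel_measurable borel"
  by (rule borel_measurable_mono) (simp add: mono_def F_mono)

text \<open>Integrate out the first pair: its first entry contributes the factor \<open>F y\<close>,
  and its decrement \<open>b\<close> moves the remaining constraints to level \<open>y + b\<close>.
  Hence the induction runs over all levels at once.\<close>

lemma emeasure_below:
  "emeasure Q {z. below n y z} = (\<integral>\<^sup>+z. ennreal (\<Prod>j<n. F (y + psum z j)) \<partial>Q)"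
proof (induction n arbitrary: y)
  case 0
  then show ?case
    using P.emeasure_space_1 by (simp add: below_def)
next
  case (Suc n)
  define G where "G b = (\<integral>\<^sup>+z. ennreal (\<Prod>j<n. F (y + b + psum z j)) \<partial>Q)" for b
  have [measurable]: "G \<in> borel_measurable \<nu>"
    unfolding G_def by measurable
  have b: "{z. below n y z} \<in> sets Q" for n y
    by (intro sets_QI) measurable
  have "emeasure Q {z. below (Suc n) y z} = (\<integral>\<^sup>+z. indicator {z. below (Suc n) y z} z \<partial>Q)"
    using b by simp
  also have "\<dots> = (\<integral>\<^sup>+a. \<integral>\<^sup>+b. \<integral>\<^sup>+z. indicator {..y} a * indicator {z. below n (y + b) z} z \<partial>Q \<partial>\<nu> \<partial>\<mu>)"
    using b by (subst nn_integral_case_nat)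
      (auto simp: below_Suc shift_def indicator_def intro!: nn_integral_cong)
  also have "\<dots> = (\<integral>\<^sup>+a. \<integral>\<^sup>+b. indicator {..y} a * G b \<partial>\<nu> \<partial>\<mu>)"
    using b by (simp add: nn_integral_cmult Suc.IH G_def)
  also have "\<dots> = ennreal (F y) * (\<integral>\<^sup>+b. G b \<partial>\<nu>)"
    by (simp add: nn_integral_cmult nn_integral_multc F_def \<mu>.emeasure_eq_measure sets_\<mu>)
  \<comment> \<open>A dummy integral over \<open>a\<close>, of total mass 1, restores the form in
    which a first pair is split off.\<close>
  also have "\<dots> = (\<integral>\<^sup>+a. \<integral>\<^sup>+b. \<integral>\<^sup>+z. ennreal (F y) * ennreal (\<Prod>j<n. F (y + b + psum z j)) \<partial>Q \<partial>\<nu> \<partial>\<mu>)"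
    by (simp add: nn_integral_cmult G_def \<mu>.emeasure_space_1[simplified])
  also have "\<dots> = (\<integral>\<^sup>+a. \<integral>\<^sup>+b. \<integral>\<^sup>+z. ennreal (\<Prod>j<Suc n. F (y + psum (case_nat (a, b) z) j)) \<partial>Q \<partial>\<nu> \<partial>\<mu>)"
  proof -
    have "(\<Prod>j<Suc n. F (y + psum (case_nat (a, b) z) j)) = F y * (\<Prod>j<n. F (y + b + psum z j))" for a b z
      by (subst prod.lessThan_Suc_shift) (simp add: add.assoc)
    then show ?thesis
      by (simp add: ennreal_mult' F_nonneg del: prod.lessThan_Suc)
  qed
  also have "\<dots> = (\<integral>\<^sup>+z. ennreal (\<Prod>j<Suc n. F (y + psum z j)) \<partial>Q)"
    by (rule nn_integral_case_nat[symmetric]) measurable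
  finally show ?case .
qed

section \<open>Divergence of the partial sums\<close>

lemma nn_integral_exp_psum:
  "(\<integral>\<^sup>+z. ennreal (exp (- psum z n)) \<partial>Q) = (\<integral>\<^sup>+b. ennreal (exp (- b)) \<partial>\<nu>) ^ n"
proof (induction n)
  case 0
  then show ?case
    using P.emeasure_space_1 by simp
next
  case (Suc n)
  have "(\<integral>\<^sup>+z. ennreal (exp (- psum z (Suc n))) \<partial>Q)
      = (\<integral>\<^sup>+a. \<integral>\<^sup>+b. \<integral>\<^sup>+z. ennreal (exp (- psum (case_nat (a, b) z) (Suc n))) \<partial>Q \<partial>\<nu> \<partial>\<mu>)"
    by (rule nn_integral_case_nat) measurable
  also have "\<dots> = (\<integral>\<^sup>+a. \<integral>\<^sup>+b. \<integral>\<^sup>+z. ennreal (exp (- b)) * ennreal (exp (- psum z n)) \<partial>Q \<partial>\<nu> \<partial>\<mu>)"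
    by (simp add: exp_diff exp_minus divide_inverse ennreal_mult' del: ennreal_1)
  also have "\<dots> = (\<integral>\<^sup>+b. ennreal (exp (- b)) \<partial>\<nu>) ^ Suc n"
    by (simp add: nn_integral_cmult nn_integral_multc Suc.IH \<mu>.emeasure_space_1[simplified])
  finally show ?case .
qed

text \<open>Since decrements are positive, their Laplace transform \<open>q\<close> at 1 is below 1.
  The expectation of \<open>exp (- psum z n)\<close> is the \<open>n\<close>-th power of
  \<open>q\<close> and tends to 0, so the infimum of these exponentials vanishes almost
  surely.\<close>

lemma psum_unbounded: "AE z in Q. \<forall>y. \<exists>n. y \<le> psum z n"
proof -
  define q where "q = (\<integral>\<^sup>+b. ennreal (exp (- b)) \<partial>\<nu>)"
  have "q < (\<integral>\<^sup>+b. 1 \<partial>\<nu>)"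
    unfolding q_def
  proof (rule nn_integral_less)
    show le: "AE b in \<nu>. ennreal (exp (- b)) \<le> 1"
      using \<nu>_pos by eventually_elim (simp add: ennreal_le_1)
    have "(\<integral>\<^sup>+b. ennreal (exp (- b)) \<partial>\<nu>) \<le> (\<integral>\<^sup>+b. 1 \<partial>\<nu>)"
      using le by (rule nn_integral_mono_AE)
    then show "(\<integral>\<^sup>+b. ennreal (exp (- b)) \<partial>\<nu>) \<noteq> \<infinity>"
      using \<nu>.emeasure_space_1 by (auto simp: top_unique)
    show "\<not> (AE b in \<nu>. 1 \<le> ennreal (exp (- b)))"
    proof
      assume "AE b in \<nu>. 1 \<le> ennreal (exp (- b))"
      with \<nu>_pos have "AE b in \<nu>. False"
        by eventually_elim simp
      then show False
        by simp
    qed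
  qed auto
  then have "q < 1"
    using \<nu>.emeasure_space_1 by simp
  then obtain r where r: "q = ennreal r" "0 \<le> r" "r < 1"
    by (cases q) auto
  define L where "L z = (INF n. ennreal (exp (- psum z n)))" for z
  have [measurable]: "L \<in> borel_measurable Q"
    unfolding L_def by measurable
  have "(\<integral>\<^sup>+z. L z \<partial>Q) \<le> ennreal (r ^ n)" for n
  proof -
    have "(\<integral>\<^sup>+z. L z \<partial>Q) \<le> (\<integral>\<^sup>+z. ennreal (exp (- psum z n)) \<partial>Q)"
      unfolding L_def by (intro nn_integral_mono INF_lower) simp
    then show ?thesis
      by (simp add: nn_integral_exp_psum q_def[symmetric] r ennreal_power)
  qed
  moreover have "(\<lambda>n. ennreal (r ^ n)) \<longlonglongrightarrow> ennreal 0"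
    using r by (intro tendsto_ennrealI LIMSEQ_realpow_zero)
  ultimately have "(\<integral>\<^sup>+z. L z \<partial>Q) \<le> ennreal 0"
    by (intro LIMSEQ_le_const) auto
  then have "AE z in Q. L z = 0"
    by (subst nn_integral_0_iff_AE[symmetric]) auto
  then show ?thesis
  proof eventually_elim
    case (elim z)
    show ?case
    proof
      fix y
      have "L z < ennreal (exp (- y))"
        using elim by simp
      then obtain n where "ennreal (exp (- psum z n)) < ennreal (exp (- y))"
        unfolding L_def INF_less_iff by auto
      then have "y \<le> psum z n"
        by (simp add: ennreal_less_iff)
      then show "\<exists>n. y \<le> psum z n" ..
    qed
  qed
qed

lemma prob_psum_ge: "(\<lambda>n. P.prob {z. y \<le> psum z n}) \<longlonglongrightarrow> 1"
proof -
  \<comment> \<open>The events \<open>y \<le> psum z n\<close> increase in \<open>n\<close> only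
    almost surely; the events \<open>?B n\<close> increase everywhere and differ from them by null
    sets.\<close>
  let ?B = "\<lambda>n. {z. \<exists>k\<le>n. y \<le> psum z k}"
  have B: "?B n \<in> sets Q" for n
    by (intro sets_QI) measurable
  have "(\<lambda>n. P.prob (?B n)) \<longlonglongrightarrow> P.prob (\<Union>n. ?B n)"
    using B by (intro P.finite_Lim_measure_incseq) (auto simp: incseq_def intro: order_trans)
  also have "P.prob (\<Union>n. ?B n) = 1"
  proof -
    have "AE z in Q. z \<in> (\<Union>n. ?B n)"
      using psum_unbounded by eventually_elim (auto, meson order_refl)
    moreover have "(\<Union>n. ?B n) \<in> sets Q"
      using B by auto
    ultimately show ?thesis
      by (simp add: P.prob_eq_1)
  qed
  also have "(\<lambda>n. P.prob (?B n)) = (\<lambda>n. P.prob {z. y \<le> psum z n})"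
  proof
    fix n
    show "P.prob (?B n) = P.prob {z. y \<le> psum z n}"
    proof (rule P.finite_measure_eq_AE)
      show "AE z in Q. z \<in> ?B n \<longleftrightarrow> z \<in> {z. y \<le> psum z n}"
        using AE_positive_seq by eventually_elim (auto intro: order_trans psum_mono)
      show "{z. y \<le> psum z n} \<in> sets Q"
        by (intro sets_QI) measurable
    qed (rule B)
  qed
  finally show ?thesis .
qed

section \<open>Recurrence of events along visits to a bounded set\<close>

text \<open>
  Let \<open>E n\<close> be the event that the chain from 0 is at most \<open>y\<close> at time \<open>n\<close> and \<open>A\<close> then holds, and \<open>W k\<close>
  the event that no \<open>E l\<close> with \<open>l \<ge> k\<close> occurs. By monotonicity a chain restarted from 0 at time \<open>n + m\<close>
  stays below the original one, so \<open>E n\<close> and \<open>W k\<close> for the restarted chain can hold together for at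
  most \<open>m + k\<close> values of \<open>n\<close>. They are independent, so a divergent sum forces \<open>W k\<close> to be null.
\<close>

lemma recurrent_event:
  assumes [measurable]: "Measurable.pred seq_space A"
    and A: "\<And>u v. A (comb_seq m u v) = A u"
    and pos: "emeasure Q {z. A z} \<noteq> 0"
    and div: "(\<Sum>n. emeasure Q {z. orbit 0 z n \<le> y}) = \<infinity>"
  shows "AE z in Q. \<exists>\<^sub>\<infinity>n. orbit 0 z n \<le> y \<and> A (shift n z)"
proof -
  define E where "E n z \<longleftrightarrow> orbit 0 z n \<le> y \<and> A (shift n z)" for n z
  define W where "W k z \<longleftrightarrow> (\<forall>l\<ge>k. \<not> E l z)" for k z
  have [measurable]: "Measurable.pred seq_space (E n)" for n
    unfolding E_def[abs_def] by measurable
  have [measurable]: "Measurable.pred seq_space (W k)" for k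
    unfolding W_def[abs_def] by measurable
  have E_comb: "E n (comb_seq (n + m) u v) = E n u" for n u v
    by (simp add: E_def orbit_comb_seq shift_comb_seq_add A)
  have few: "(\<Sum>n. indicator {z. E n z \<and> W k (shift (n + m) z)} z) \<le> (of_nat (m + k) :: ennreal)"
    if z: "positive_seq z" for k z
  proof -
    define I where "I = {n. E n z \<and> W k (shift (n + m) z)}"
    \<comment> \<open>If \<open>n'\<close> lay beyond this bound, monotonicity would make
      \<open>E n'\<close> an occurrence of \<open>E l\<close> with \<open>l \<ge> k\<close> for the
      chain restarted at \<open>n + m\<close>, against \<open>W k\<close>.\<close>
    have gap: "n' < n + m + k" if "n \<in> I" "n' \<in> I" for n n'
    proof (rule ccontr)
      assume "\<not> n' < n + m + k"
      then obtain l where l: "l \<ge> k" "n' = (n + m) + l"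
        by (metis add.assoc le_add1 le_iff_add not_less)
      have "orbit 0 (shift (n + m) z) l \<le> y"
        using orbit_shift_le[OF z, of "n + m" l] that by (simp add: I_def E_def l)
      moreover have "A (shift l (shift (n + m) z))"
        using that by (simp add: I_def E_def l shift_shift)
      ultimately show False
        using that l by (auto simp: I_def W_def E_def)
    qed
    have "finite I \<and> card I \<le> m + k"
    proof (cases "I = {}")
      case False
      \<comment> \<open>All of \<open>I\<close> fits into a window of length \<open>m + k\<close>
        that starts at its least element.\<close>
      then have "I \<subseteq> {Inf I..<Inf I + (m + k)}"
        using gap[OF Inf_nat_def1] by (auto simp: add.assoc intro!: wellorder_Inf_le1)
      then show ?thesis
        using card_mono[of "{Inf I..<Inf I + (m + k)}" I] by (auto intro: finite_subset)
    qed simp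
    moreover have "(\<Sum>n. indicator {z. E n z \<and> W k (shift (n + m) z)} z) = (\<Sum>n\<in>I. 1 :: ennreal)"
      using calculation by (subst suminf_finite[of I]) (auto simp: I_def)
    ultimately show ?thesis
      using of_nat_mono[of "card I" "m + k", where 'a = ennreal] by simp
  qed
  have "emeasure Q {z. W k z} = 0" for k
  proof -
    have [measurable]: "{z. E n z \<and> W k (shift (n + m) z)} \<in> sets Q" for n
      by (intro sets_QI) measurable
    \<comment> \<open>Both factorisations are used: the visit at \<open>n\<close>, the block
      \<open>A\<close> after it and \<open>W k\<close> after the block read disjoint stretches of
      the sequence.\<close>
    have "(\<Sum>n. emeasure Q {z. orbit 0 z n \<le> y}) * (emeasure Q {z. A z} * emeasure Q {z. W k z})
      = (\<Sum>n. emeasure Q {z. orbit 0 z n \<le> y} * (emeasure Q {z. A z} * emeasure Q {z. W k z}))"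
      by (simp add: ennreal_suminf_multc)
    also have "\<dots> = (\<Sum>n. emeasure Q {z. E n z \<and> W k (shift (n + m) z)})"
    proof (rule suminf_cong)
      fix n
      have "emeasure Q {z. E n z \<and> W k (shift (n + m) z)} = emeasure Q {z. E n z} * emeasure Q {z. W k z}"
        by (intro emeasure_conj_shift E_comb) measurable
      also have "emeasure Q {z. E n z} = emeasure Q {z. orbit 0 z n \<le> y} * emeasure Q {z. A z}"
        unfolding E_def by (intro emeasure_conj_shift) (measurable, simp add: orbit_comb_seq)
      finally show "emeasure Q {z. orbit 0 z n \<le> y} * (emeasure Q {z. A z} * emeasure Q {z. W k z})
        = emeasure Q {z. E n z \<and> W k (shift (n + m) z)}"
        by (simp add: mult.assoc)
    qed
    also have "\<dots> = (\<integral>\<^sup>+z. (\<Sum>n. indicator {z. E n z \<and> W k (shift (n + m) z)} z) \<partial>Q)"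
      by (subst nn_integral_suminf) auto
    also have "\<dots> \<le> (\<integral>\<^sup>+z. of_nat (m + k) \<partial>Q)"
      using AE_positive_seq by (intro nn_integral_mono_AE) (erule eventually_mono, rule few)
    also have "\<dots> < \<infinity>"
      using P.emeasure_space_1 by (simp add: of_nat_less_top)
    finally show ?thesis
      \<comment> \<open>An infinite sum times a constant is finite, so the constant is 0; as
        \<open>A\<close> has positive probability, \<open>W k\<close> is null.\<close>
      using pos by (auto simp: div ennreal_top_mult split: if_splits)
  qed
  then have "AE z in Q. \<not> W k z" for k
    by (subst AE_iff_measurable[of "{z. W k z}"]) (auto intro!: sets_QI)
  then have "AE z in Q. \<forall>k. \<not> W k z"
    by (simp add: AE_all_countable)
  then show ?thesis
    by eventually_elim (auto simp: W_def E_def INFM_nat_le)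
qed

section \<open>Time reversal in law\<close>

text \<open>A product of identical factors is invariant under injective reindexing; the indices from
  \<open>n\<close> on are left fixed so that the map acts on whole sequences.\<close>

lemma distr_reverse:
  "distr Q Q (\<lambda>z k. z (if k < n then n - Suc k else k)) = Q"
proof -
  let ?f = "\<lambda>k. if k < n then n - Suc k else k"
  have "inj ?f"
    by (auto simp: inj_on_def split: if_splits)
  then show ?thesis
    using distr_PiM_reindex[of UNIV "\<lambda>_. \<mu> \<Otimes>\<^sub>M \<nu>" ?f UNIV]
    by (simp add: prob_space restrict_UNIV)
qed

text \<open>Reversing the first \<open>n\<close> pairs preserves \<open>Q\<close> and leaves
  \<open>psum z n\<close> unchanged, so the pathwise reversal of \<open>orbit_le_iff\<close> can be
  undone in law.\<close>

lemma emeasure_orbit_le: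
  "emeasure Q {z. orbit x z n \<le> y} = emeasure Q {z. x \<le> y + psum z n \<and> below n y z}"
proof -
  let ?r = "\<lambda>z k. z (if k < n then n - Suc k else k)"
  have r[measurable]: "?r \<in> seq_space \<rightarrow>\<^sub>M seq_space"
    by (rule measurable_PiM_single') (auto simp: space_PiM space_pair_measure)
  have psum_r: "psum (?r z) n = psum z n" for z
    unfolding psum_def by (rule sum.reindex_bij_witness[of _ "\<lambda>k. n - Suc k" "\<lambda>k. n - Suc k"]) auto
  have below_r: "below n y (\<lambda>k. z (n - Suc k)) = below n y (?r z)" for z
    by (rule below_cong) simp
  have B: "{z. x \<le> y + psum z n \<and> below n y z} \<in> sets Q"
    by (intro sets_QI) measurable
  have "emeasure Q {z. x \<le> y + psum z n \<and> below n y z}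
    = emeasure (distr Q Q ?r) {z. x \<le> y + psum z n \<and> below n y z}"
    by (simp only: distr_reverse)
  also have "\<dots> = emeasure Q {z. x \<le> y + psum (?r z) n \<and> below n y (?r z)}"
    using B by (subst emeasure_distr) (auto intro!: arg_cong[where f="emeasure Q"] )
  also have "\<dots> = emeasure Q {z. orbit x z n \<le> y}"
    by (simp only: orbit_le_iff psum_r below_r)
  finally show ?thesis ..
qed

lemma emeasure_orbit_le_below: "emeasure Q {z. orbit x z n \<le> y} \<le> emeasure Q {z. below n y z}"
  unfolding emeasure_orbit_le by (intro emeasure_mono sets_QI) (auto, measurable)

lemma emeasure_orbit_0_le:
  assumes "0 \<le> y"
  shows "emeasure Q {z. orbit 0 z n \<le> y} = emeasure Q {z. below n y z}"
  unfolding emeasure_orbit_le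
proof (rule emeasure_eq_AE)
  show "AE z in Q. z \<in> {z. 0 \<le> y + psum z n \<and> below n y z} \<longleftrightarrow> z \<in> {z. below n y z}"
    using AE_positive_seq by eventually_elim (use assms in \<open>simp add: psum_nonneg\<close>)
qed (intro sets_QI; measurable)+

section \<open>The Markov chain and its path laws\<close>

definition law :: "real \<Rightarrow> (nat \<Rightarrow> real) measure" where
  "law x = distr Q path_space (orbit x)"

lemma measurable_orbit_path [measurable]: "orbit x \<in> seq_space \<rightarrow>\<^sub>M path_space"
  by (rule measurable_PiM_single') auto

lemma space_law [simp]: "space (law x) = UNIV" and sets_law [measurable_cong, simp]: "sets (law x) = sets path_space"
  by (simp_all add: law_def space_PiM)

lemma prob_space_law: "prob_space (law x)"
  unfolding law_def by (rule P.prob_space_distr) measurable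

lemma AE_law:
  assumes [measurable]: "Measurable.pred path_space R" and "AE z in Q. R (orbit x z)"
  shows "AE \<xi> in law x. R \<xi>"
proof -
  have "{\<xi> \<in> space path_space. R \<xi>} \<in> sets path_space"
    by measurable
  then show ?thesis
    unfolding law_def using assms(2) by (subst AE_distr_iff) (auto simp del: space_PiM)
qed

lemma emeasure_law:
  assumes [measurable]: "Measurable.pred path_space R"
  shows "emeasure (law x) {\<xi>. R \<xi>} = emeasure Q {z. R (orbit x z)}"
proof -
  have "{\<xi>. R \<xi>} \<in> sets path_space"
    using predE[OF assms] by (simp add: space_PiM)
  then show ?thesis
    unfolding law_def by (subst emeasure_distr) (auto simp: vimage_def)
qed

text \<open>Only \<open>v 0\<close> matters for one step, but the integral is kept over all of
  \<open>Q\<close> so that it matches the inner integral produced by splitting a sequence at time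
  \<open>n\<close>.\<close>

lemma transition_law:
  assumes [measurable]: "B \<in> sets borel"
  shows "transition law x B = (\<integral>\<^sup>+v. indicator B (max (x - snd (v 0)) (fst (v 0))) \<partial>Q)"
proof -
  have "transition law x B = emeasure Q {v. max (x - snd (v 0)) (fst (v 0)) \<in> B}"
    unfolding transition_def by (simp add: emeasure_law)
  also have "\<dots> = (\<integral>\<^sup>+v. indicator {v. max (x - snd (v 0)) (fst (v 0)) \<in> B} v \<partial>Q)"
    by (intro nn_integral_indicator[symmetric] sets_QI) measurable
  finally show ?thesis
    by (simp add: indicator_def)
qed

lemma measurable_transition_law [measurable]:
  assumes [measurable]: "B \<in> sets borel"
  shows "(\<lambda>x. transition law x B) \<in> borel_measurable borel"
  unfolding transition_law[OF assms] by measurable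

text \<open>Splitting the driving sequence at \<open>n\<close> makes the history a function of
  \<open>u\<close> and the next step a function of \<open>orbit x u n\<close> and the independent
  pair \<open>v 0\<close>.\<close>

lemma markov_chain_law: "markov_chain_on {0..} law"
  unfolding markov_chain_on_def
proof (intro conjI ballI allI)
  fix x :: real assume "x \<in> {0..}"
  then have x: "0 \<le> x" by simp
  show "prob_space (law x)"
    by (rule prob_space_law)
  show "sets (law x) = sets path_space"
    by simp
  show "AE \<xi> in law x. \<xi> 0 = x"
    by (rule AE_law) auto
  show "AE \<xi> in law x. \<forall>n. \<xi> n \<in> {0..}"
    using AE_positive_seq x by (intro AE_law) (auto elim!: eventually_mono simp: orbit_nonneg)
next
  fix B :: "real set" assume "B \<in> sets borel"
  then show "(\<lambda>x. transition law x B) \<in> borel_measurable (restrict_space borel {0..})"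
    by (intro measurable_restrict_space1 measurable_transition_law)
next
  fix x :: real and n :: nat and A and B :: "real set"
  assume [measurable]: "A \<in> sets (\<Pi>\<^sub>M i\<in>{..n}. borel :: real measure)" "B \<in> sets borel"
  have [measurable]: "(\<lambda>\<xi>. restrict \<xi> {..n}) \<in> path_space \<rightarrow>\<^sub>M (\<Pi>\<^sub>M i\<in>{..n}. borel)"
    by (rule measurable_restrict_subset) simp
  have res: "restrict (orbit x (comb_seq n u v)) {..n} = restrict (orbit x u) {..n}" for u v
    by (auto simp: restrict_def orbit_comb_seq)
  have step: "orbit x (comb_seq n u v) (Suc n) = max (orbit x u n - snd (v 0)) (fst (v 0))" for u v
    by (simp add: orbit_comb_seq comb_seq_def[of n u v n])
  have "emeasure (law x) {\<xi> \<in> space (law x). restrict \<xi> {..n} \<in> A \<and> \<xi> (Suc n) \<in> B}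
    = emeasure Q {z. restrict (orbit x z) {..n} \<in> A \<and> orbit x z (Suc n) \<in> B}"
    by (simp add: emeasure_law)
  also have "\<dots> = (\<integral>\<^sup>+z. indicator {z. restrict (orbit x z) {..n} \<in> A \<and> orbit x z (Suc n) \<in> B} z \<partial>Q)"
    by (intro nn_integral_indicator[symmetric] sets_QI) measurable
  also have "\<dots> = (\<integral>\<^sup>+z. indicator A (restrict (orbit x z) {..n}) * indicator B (orbit x z (Suc n)) \<partial>Q)"
    by (intro nn_integral_cong) (simp add: indicator_def)
  also have "\<dots> = (\<integral>\<^sup>+u. \<integral>\<^sup>+v. indicator A (restrict (orbit x u) {..n}) *
      indicator B (max (orbit x u n - snd (v 0)) (fst (v 0))) \<partial>Q \<partial>Q)"
    by (subst nn_integral_comb_seq[of _ n]) (simp_all only: res step, measurable)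
  also have "\<dots> = (\<integral>\<^sup>+u. indicator A (restrict (orbit x u) {..n}) * transition law (orbit x u n) B \<partial>Q)"
    by (intro nn_integral_cong) (simp add: transition_law nn_integral_cmult)
  also have "\<dots> = (\<integral>\<^sup>+\<xi>. indicator A (restrict \<xi> {..n}) * transition law (\<xi> n) B \<partial>law x)"
    unfolding law_def by (subst nn_integral_distr) (simp_all only: law_def[symmetric], measurable)
  finally show "emeasure (law x) {\<xi> \<in> space (law x). restrict \<xi> {..n} \<in> A \<and> \<xi> (Suc n) \<in> B}
    = (\<integral>\<^sup>+\<xi>. indicator A (restrict \<xi> {..n}) * transition law (\<xi> n) B \<partial>law x)" .
qed

section \<open>Harris recurrence\<close>

text \<open>A block of \<open>m\<close> steps with total decrement above \<open>y\<close>, begun at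
  a state in \<open>[0, y]\<close>, ends where a block begun at 0 would end. Such blocks ending in
  \<open>B\<close> recur by \<open>recurrent_event\<close>.\<close>

lemma recurrent_set:
  assumes [measurable]: "B \<in> sets borel"
    and pos: "emeasure Q {z. orbit 0 z m \<in> B \<and> y < psum z m} \<noteq> 0"
    and div: "(\<Sum>n. emeasure Q {z. orbit 0 z n \<le> y}) = \<infinity>"
    and x: "0 \<le> x"
  shows "AE z in Q. \<exists>\<^sub>\<infinity>n. orbit x z n \<in> B"
proof -
  have "AE z in Q. \<exists>\<^sub>\<infinity>n. orbit 0 z n \<le> y \<and> (orbit 0 (shift n z) m \<in> B \<and> y < psum (shift n z) m)"
    using pos div by (intro recurrent_event[where m = m]) (measurable, simp_all add: orbit_comb_seq psum_comb_seq)
  with AE_positive_seq psum_unbounded show ?thesis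
  proof eventually_elim
    case (elim z)
    \<comment> \<open>From time \<open>n\<^sub>0\<close> on, the chains from \<open>x\<close> and
      from 0 coincide.\<close>
    obtain n\<^sub>0 where n\<^sub>0: "x \<le> psum z n\<^sub>0"
      using elim by blast
    show ?case
      unfolding INFM_nat_le
    proof
      fix k
      obtain n where n: "n \<ge> max k n\<^sub>0" "orbit 0 z n \<le> y" "orbit 0 (shift n z) m \<in> B" "y < psum (shift n z) m"
        using elim(3) unfolding INFM_nat_le by blast
      have "orbit 0 z (n + m) = orbit 0 (shift n z) m"
        using n elim(1) unfolding orbit_add
        by (intro orbit_coalesce orbit_nonneg positive_seq_shift) auto
      moreover have "orbit x z (n + m) = orbit 0 z (n + m)"
      proof (intro orbit_coalesce)
        show "x \<le> psum z (n + m)"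
          using n\<^sub>0 n psum_mono[OF elim(1), of n\<^sub>0 "n + m"] by auto
      qed (use elim x in auto)
      ultimately have "orbit x z (n + m) \<in> B"
        using n by simp
      with n show "\<exists>n\<ge>k. orbit x z n \<in> B"
        by (intro exI[of _ "n + m"]) auto
    qed
  qed
qed

text \<open>The measure \<psi> is the law of the endpoint of an \<open>m\<close>-step block from 0,
  restricted to blocks with total decrement above \<open>y\<close>; \<open>m\<close> is chosen to
  give it positive mass.\<close>

lemma harris_recurrent_law:
  assumes div: "(\<Sum>n. emeasure Q {z. orbit 0 z n \<le> y}) = \<infinity>"
  shows "harris_recurrent {0..} law"
  unfolding harris_recurrent_def
proof (intro conjI markov_chain_law)
  \<comment> \<open>The level \<open>y + 1\<close> turns the weak inequality into the strict one
    required in \<open>D\<close>.\<close>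
  obtain m where m: "P.prob {z. y + 1 \<le> psum z m} > 1 / 2"
    using order_tendstoD(1)[OF prob_psum_ge, of "1 / 2" "y + 1"]
    by (auto simp: eventually_sequentially)
  \<comment> \<open>On \<open>D\<close>, all chains started in \<open>[0, y]\<close> have coalesced by time \<open>m\<close>.\<close>
  define D where "D = {z. y < psum z m}"
  have D[measurable]: "D \<in> sets Q"
    unfolding D_def by (intro sets_QI) measurable
  have "P.prob {z. y + 1 \<le> psum z m} \<le> P.prob D"
    by (intro P.finite_measure_mono D) (auto simp: D_def)
  then have D_pos: "emeasure Q D \<noteq> 0"
    using m by (simp add: P.emeasure_eq_measure)
  define N where "N = distr (density Q (indicator D)) borel (\<lambda>z. orbit 0 z m)"
  have N: "emeasure N B = emeasure Q {z. orbit 0 z m \<in> B \<and> y < psum z m}" if [measurable]: "B \<in> sets borel" for B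
  proof -
    have B: "{z. orbit 0 z m \<in> B} \<in> sets Q"
      by (intro sets_QI) measurable
    have "emeasure N B = emeasure (density Q (indicator D)) {z. orbit 0 z m \<in> B}"
      unfolding N_def by (subst emeasure_distr) (auto simp: vimage_def)
    also have "\<dots> = emeasure Q (D \<inter> {z. orbit 0 z m \<in> B})"
      using B by (intro emeasure_restricted) auto
    finally show ?thesis
      by (simp add: D_def Int_def conj_commute)
  qed
  define \<psi> where "\<psi> = restrict_space N {0..}"
  have \<psi>: "emeasure \<psi> B = emeasure Q {z. orbit 0 z m \<in> B \<and> y < psum z m}"
    if "B \<in> sets borel" "B \<subseteq> {0..}" for B
    using that unfolding \<psi>_def by (subst emeasure_restrict_space) (auto simp: N, simp add: N_def)
  have sets_\<psi>: "sets \<psi> = sets (restrict_space borel {0..})"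
    unfolding \<psi>_def by (rule sets_restrict_space_cong) (simp add: N_def)
  show "\<exists>\<psi>. sets \<psi> = sets (restrict_space borel {0..}) \<and> sigma_finite_measure \<psi> \<and>
      emeasure \<psi> {0..} \<noteq> 0 \<and>
      (\<forall>B\<in>sets \<psi>. emeasure \<psi> B > 0 \<longrightarrow>
         (\<forall>x\<in>{0..}. \<P>(\<xi> in law x. \<exists>\<^sub>\<infinity>n. \<xi> n \<in> B) = 1))"
  proof (intro exI[of _ \<psi>] conjI ballI impI)
    show "sets \<psi> = sets (restrict_space borel {0..})"
      by (rule sets_\<psi>)
    have "space \<psi> = {0..}"
      using sets_eq_imp_space_eq[OF sets_\<psi>] by (simp add: space_restrict_space)
    then show "sigma_finite_measure \<psi>"
      by (intro finite_measure.sigma_finite_measure finite_measureI) (simp add: \<psi>)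
    have "emeasure Q {z. orbit 0 z m \<in> {0..} \<and> y < psum z m} = emeasure Q D"
    proof (rule emeasure_eq_AE)
      show "AE z in Q. z \<in> {z. orbit 0 z m \<in> {0..} \<and> y < psum z m} \<longleftrightarrow> z \<in> D"
        using AE_positive_seq by eventually_elim (simp add: orbit_nonneg D_def)
      show "{z. orbit 0 z m \<in> {0..} \<and> y < psum z m} \<in> sets Q"
        by (intro sets_QI) measurable
    qed (rule D)
    then show "emeasure \<psi> {0..} \<noteq> 0"
      using D_pos by (simp add: \<psi>)
  next
    fix B and x :: real assume B: "B \<in> sets \<psi>" "emeasure \<psi> B > 0" and "x \<in> {0..}"
    then have B': "B \<in> sets borel" "B \<subseteq> {0..}" and x: "0 \<le> x"
      unfolding sets_\<psi> by (auto simp: sets_restrict_space_iff)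
    note B'(1)[measurable]
    interpret L: prob_space "law x"
      by (rule prob_space_law)
    have "AE z in Q. \<exists>\<^sub>\<infinity>n. orbit x z n \<in> B"
      using B B' by (intro recurrent_set[OF _ _ div x, of B m]) (auto simp: \<psi>)
    then have "AE \<xi> in law x. \<exists>\<^sub>\<infinity>n. \<xi> n \<in> B"
      by (intro AE_law) (simp_all add: INFM_nat_le)
    moreover have "{\<xi> \<in> space path_space. \<forall>k. \<exists>n\<ge>k. \<xi> n \<in> B} \<in> sets path_space"
      by measurable
    ultimately show "\<P>(\<xi> in law x. \<exists>\<^sub>\<infinity>n. \<xi> n \<in> B) = 1"
      by (subst L.prob_Collect_eq_1) (simp_all add: INFM_nat_le space_PiM)
  qed
qed

end

section \<open>The all-time maximum\<close>

definition Xi :: "(nat \<Rightarrow> real \<times> real) \<Rightarrow> ereal" where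
  "Xi z = max 0 (SUP j. ereal (fst (z j) - psum z j))"

lemma measurable_Xi [measurable (raw)]:
  assumes [measurable]: "f \<in> N \<rightarrow>\<^sub>M seq_space"
  shows "(\<lambda>x. Xi (f x)) \<in> borel_measurable N"
  unfolding Xi_def by measurable

lemma Xi_nonneg: "0 \<le> Xi z"
  by (simp add: Xi_def)

lemma Xi_le_iff: "0 \<le> y \<Longrightarrow> Xi z \<le> ereal y \<longleftrightarrow> (\<forall>n. below n y z)"
  by (auto simp: Xi_def SUP_le_iff below_def algebra_simps)

lemma below_case_nat: "below (Suc n) y (case_nat p z) \<longleftrightarrow> fst p \<le> y \<and> below n (y + snd p) z"
  by (simp add: below_Suc shift_def)

lemma below_antimono: "m \<le> n \<Longrightarrow> below n y z \<Longrightarrow> below m y z"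
  by (auto simp: below_def)

text \<open>Both sides are nonnegative and lie below the same levels \<open>y \<ge> 0\<close>, hence
  they agree. This is the chain's own recursion, the source of stationarity.\<close>

lemma Xi_case_nat:
  assumes Xi: "Xi z = ereal x" and a: "0 < a" and b: "0 < b"
  shows "Xi (case_nat (a, b) z) = ereal (max (x - b) a)"
proof -
  have le: "Xi (case_nat (a, b) z) \<le> ereal y \<longleftrightarrow> max (x - b) a \<le> y" if y: "0 \<le> y" for y
  proof -
    have "Xi (case_nat (a, b) z) \<le> ereal y \<longleftrightarrow> (\<forall>n. below (Suc n) y (case_nat (a, b) z))"
      unfolding Xi_le_iff[OF y] by (meson below_antimono le_SucI order_refl)
    also have "\<dots> \<longleftrightarrow> a \<le> y \<and> Xi z \<le> ereal (y + b)"
      using y b by (subst Xi_le_iff) (auto simp: below_case_nat)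
    finally show ?thesis
      by (auto simp: Xi)
  qed
  show ?thesis
  proof (rule antisym)
    show upper: "Xi (case_nat (a, b) z) \<le> ereal (max (x - b) a)"
      using a by (subst le) auto
    obtain r where r: "Xi (case_nat (a, b) z) = ereal r" "0 \<le> r"
      using upper Xi_nonneg[of "case_nat (a, b) z"]
      by (cases "Xi (case_nat (a, b) z)") (auto simp del: ereal_max)
    then show "ereal (max (x - b) a) \<le> Xi (case_nat (a, b) z)"
      using le[of r] by simp
  qed
qed

section \<open>Comparison of products with sums\<close>

lemma suminf_ennreal_less_top_iff:
  assumes "\<And>i. 0 \<le> f i"
  shows "(\<Sum>i. ennreal (f i)) < \<infinity> \<longleftrightarrow> summable f"
proof
  assume "(\<Sum>i. ennreal (f i)) < \<infinity>"
  then show "summable f"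
    using assms by (intro summable_suminf_not_top) auto
next
  assume "summable f"
  then show "(\<Sum>i. ennreal (f i)) < \<infinity>"
    using assms by (subst suminf_ennreal2) auto
qed

text \<open>Weierstrass product inequality: the next factor lowers the product, which lies in
  \<open>[0, 1]\<close>, by at most \<open>f n\<close>.\<close>

lemma prod_one_minus_ge:
  fixes f :: "nat \<Rightarrow> real"
  assumes "\<And>i. 0 \<le> f i" "\<And>i. f i \<le> 1"
  shows "1 - (\<Sum>i<n. f i) \<le> (\<Prod>i<n. 1 - f i)"
proof (induction n)
  case (Suc n)
  have "0 \<le> (\<Prod>i<n. 1 - f i)" "(\<Prod>i<n. 1 - f i) \<le> 1"
    using assms by (auto intro!: prod_nonneg prod_le_1)
  then have "(\<Prod>i<n. 1 - f i) * f n \<le> f n"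
    using assms by (intro mult_left_le_one_le) auto
  with Suc show ?case
    by (simp add: algebra_simps)
qed simp

lemma prod_le_exp_minus_sum:
  fixes f :: "nat \<Rightarrow> real"
  assumes "\<And>i. f i \<le> 1"
  shows "(\<Prod>i<n. 1 - f i) \<le> exp (- (\<Sum>i<n. f i))"
proof -
  have "(\<Prod>i<n. 1 - f i) \<le> (\<Prod>i<n. exp (- f i))"
    using assms exp_ge_add_one_self[of "- f i" for i] by (intro prod_mono) auto
  then show ?thesis
    by (simp add: exp_sum flip: sum_negf)
qed

section \<open>Finiteness of the maximum and summability of the tails\<close>

context driving_laws begin

definition Fb :: "real \<Rightarrow> real" where "Fb x = 1 - F x"

lemma Fb_nonneg [simp]: "0 \<le> Fb x" and Fb_le_1 [simp]: "Fb x \<le> 1"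
  using F_nonneg[of x] F_le_1[of x] by (simp_all add: Fb_def)

lemma Fb_antimono: "x \<le> y \<Longrightarrow> Fb y \<le> Fb x"
  by (simp add: Fb_def F_mono)

lemma measurable_Fb [measurable]: "Fb \<in> borel_measurable borel"
  unfolding Fb_def[abs_def] by measurable

lemma F_lim: "(\<lambda>k. F (real k + c)) \<longlonglongrightarrow> 1"
proof -
  have "(\<lambda>k. measure \<mu> {..real k + c}) \<longlonglongrightarrow> measure \<mu> (\<Union>k. {..real k + c})"
    by (intro \<mu>.finite_Lim_measure_incseq) (auto simp: incseq_def sets_\<mu>)
  also have "(\<Union>k. {..real k + c}) = space \<mu>"
  proof -
    have "\<exists>k. x \<le> real k + c" for x
      using real_arch_simple[of "x - c"] by (auto simp: algebra_simps)
    then show ?thesis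
      by auto
  qed
  finally show ?thesis
    by (simp add: F_def \<mu>.prob_space[simplified])
qed

text \<open>Continuity from above along the decreasing events \<open>below n y\<close>.\<close>

lemma emeasure_Xi_le:
  assumes "0 \<le> y"
  shows "emeasure Q {z. Xi z \<le> ereal y} = (INF n. emeasure Q {z. below n y z})"
proof -
  have "(INF n. emeasure Q {z. below n y z}) = emeasure Q (\<Inter>n. {z. below n y z})"
  proof (rule INF_emeasure_decseq)
    show "range (\<lambda>n. {z. below n y z}) \<subseteq> sets Q"
      by (auto intro!: sets_QI)
    show "decseq (\<lambda>n. {z. below n y z})"
      by (auto simp: decseq_def intro: below_antimono)
  qed simp
  also have "(\<Inter>n. {z. below n y z}) = {z. Xi z \<le> ereal y}"
    using assms by (auto simp: Xi_le_iff)
  finally show ?thesis ..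
qed

lemma prob_Xi_le: "(\<lambda>k. P.prob {z. Xi z \<le> ereal (real k)}) \<longlonglongrightarrow> P.prob {z. Xi z \<noteq> \<infinity>}"
proof -
  have "(\<lambda>k. P.prob {z. Xi z \<le> ereal (real k)}) \<longlonglongrightarrow> P.prob (\<Union>k. {z. Xi z \<le> ereal (real k)})"
    by (intro P.finite_Lim_measure_incseq) (auto intro!: sets_QI simp: incseq_def intro: order_trans)
  also have "(\<Union>k. {z. Xi z \<le> ereal (real k)}) = {z. Xi z \<noteq> \<infinity>}"
  proof (intro set_eqI iffI)
    fix z assume "z \<in> {z. Xi z \<noteq> \<infinity>}"
    then obtain x where "Xi z = ereal x"
      using Xi_nonneg[of z] by (cases "Xi z") auto
    then show "z \<in> (\<Union>k. {z. Xi z \<le> ereal (real k)})"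
      using real_arch_simple[of x] by auto
  qed auto
  finally show ?thesis .
qed

lemma Xi_finite_iff: "(AE z in Q. Xi z \<noteq> \<infinity>) \<longleftrightarrow> P.prob {z. Xi z \<noteq> \<infinity>} = 1"
  using P.prob_Collect_eq_1[of "\<lambda>z. Xi z \<noteq> \<infinity>"] by (simp add: sets_QI)

text \<open>By the product inequality the bound holds for every finite horizon \<open>n\<close>.
  Capping the sum at 1 keeps the integrand bounded even if the sum has infinite expectation.\<close>

lemma Xi_le_lower_bound:
  "1 - (\<integral>\<^sup>+z. min 1 (\<Sum>j. ennreal (Fb (real k + psum z j))) \<partial>Q) \<le> emeasure Q {z. Xi z \<le> ereal (real k)}"
proof -
  let ?g = "\<lambda>z. min 1 (\<Sum>j. ennreal (Fb (real k + psum z j)))"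
  have "1 - (\<integral>\<^sup>+z. ?g z \<partial>Q) \<le> emeasure Q {z. below n (real k) z}" for n
  proof -
    \<comment> \<open>The inequality is stated additively to avoid truncated subtraction in
      \<open>ennreal\<close>.\<close>
    have pointwise: "1 \<le> ?g z + ennreal (\<Prod>j<n. F (real k + psum z j))" for z
    proof (cases "1 \<le> (\<Sum>j. ennreal (Fb (real k + psum z j)))")
      case False
      let ?f = "\<lambda>j. Fb (real k + psum z j)"
      have "1 \<le> (\<Sum>j<n. ?f j) + (\<Prod>j<n. F (real k + psum z j))"
        using prod_one_minus_ge[of ?f n, OF Fb_nonneg Fb_le_1] by (simp add: Fb_def)
      then have "ennreal 1 \<le> ennreal ((\<Sum>j<n. ?f j) + (\<Prod>j<n. F (real k + psum z j)))"
        by (rule ennreal_leI)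
      also have "\<dots> = (\<Sum>j<n. ennreal (?f j)) + ennreal (\<Prod>j<n. F (real k + psum z j))"
        by (simp add: sum_nonneg prod_nonneg F_nonneg)
      also have "\<dots> \<le> (\<Sum>j. ennreal (?f j)) + ennreal (\<Prod>j<n. F (real k + psum z j))"
        by (intro add_right_mono sum_le_suminf) auto
      finally show ?thesis
        using False by (simp add: min_def)
    qed (simp add: min_def)
    have "1 = (\<integral>\<^sup>+z. 1 \<partial>Q)"
      using P.emeasure_space_1 by simp
    also have "\<dots> \<le> (\<integral>\<^sup>+z. ?g z + ennreal (\<Prod>j<n. F (real k + psum z j)) \<partial>Q)"
      by (intro nn_integral_mono pointwise)
    also have "\<dots> = (\<integral>\<^sup>+z. ?g z \<partial>Q) + emeasure Q {z. below n (real k) z}"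
      unfolding emeasure_below by (rule nn_integral_add) measurable
    finally show ?thesis
      by (simp add: ennreal_minus_le_iff)
  qed
  then show ?thesis
    by (simp add: emeasure_Xi_le INF_greatest)
qed

text \<open>Dominated convergence for the counting measure, with the summands at level 0 as
  majorant.\<close>

lemma tail_sum_tendsto_0:
  assumes "summable (\<lambda>j. Fb (psum z j))"
  shows "(\<lambda>k. \<Sum>j. ennreal (Fb (real k + psum z j))) \<longlonglongrightarrow> 0"
proof -
  have "(\<lambda>k. \<integral>\<^sup>+j. ennreal (Fb (real k + psum z j)) \<partial>count_space UNIV)
    \<longlonglongrightarrow> (\<integral>\<^sup>+j. 0 \<partial>count_space (UNIV :: nat set))"
  proof (rule nn_integral_dominated_convergence[where w = "\<lambda>j. ennreal (Fb (psum z j))"])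
    show "(\<integral>\<^sup>+j. ennreal (Fb (psum z j)) \<partial>count_space UNIV) < \<infinity>"
      unfolding nn_integral_count_space_nat
      using suminf_ennreal_less_top_iff[of "\<lambda>j. Fb (psum z j)", OF Fb_nonneg] assms by blast
    show "AE j in count_space UNIV. (\<lambda>k. ennreal (Fb (real k + psum z j))) \<longlonglongrightarrow> 0"
    proof (intro AE_I2)
      fix j
      have "(\<lambda>k. Fb (real k + psum z j)) \<longlonglongrightarrow> 1 - 1"
        unfolding Fb_def by (intro tendsto_diff tendsto_const F_lim)
      from tendsto_ennrealI[OF this]
      show "(\<lambda>k. ennreal (Fb (real k + psum z j))) \<longlonglongrightarrow> 0"
        by (simp only: diff_self ennreal_0)
    qed
    show "AE j in count_space UNIV. ennreal (Fb (real k + psum z j)) \<le> ennreal (Fb (psum z j))" for k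
      by (intro AE_I2 ennreal_leI Fb_antimono) simp
  qed simp_all
  then show ?thesis
    by (simp only: nn_integral_count_space_nat nn_integral_const mult_zero_left suminf_zero)
qed

lemma expected_truncated_tail_sum_tendsto_0:
  assumes "AE z in Q. summable (\<lambda>j. Fb (psum z j))"
  shows "(\<lambda>k. \<integral>\<^sup>+z. min 1 (\<Sum>j. ennreal (Fb (real k + psum z j))) \<partial>Q) \<longlonglongrightarrow> 0"
proof -
  let ?g = "\<lambda>k z. \<Sum>j. ennreal (Fb (real k + psum z j))"
  have meas: "(\<lambda>z. min 1 (?g k z)) \<in> borel_measurable Q" for k
    by measurable
  have "(\<lambda>k. \<integral>\<^sup>+z. min 1 (?g k z) \<partial>Q) \<longlonglongrightarrow> (\<integral>\<^sup>+z. 0 \<partial>Q)"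
  proof (rule nn_integral_dominated_convergence[where w = "\<lambda>_. 1"])
    show "AE z in Q. (\<lambda>k. min 1 (?g k z)) \<longlonglongrightarrow> 0"
      using assms
    proof eventually_elim
      case (elim z)
      show ?case
      proof (rule tendsto_sandwich[OF _ _ tendsto_const tail_sum_tendsto_0[OF elim]])
        show "\<forall>\<^sub>F k in sequentially. 0 \<le> min 1 (?g k z)"
          by (intro always_eventually allI zero_le)
        show "\<forall>\<^sub>F k in sequentially. min 1 (?g k z) \<le> ?g k z"
          by (intro always_eventually allI min.cobounded2)
      qed
    qed
    show "AE z in Q. min 1 (?g k z) \<le> 1" for k
      by (intro AE_I2 min.cobounded1)
    show "(\<integral>\<^sup>+z. 1 \<partial>Q) < \<infinity>"
      using P.emeasure_space_1 by simp
  qed (rule meas borel_measurable_const)+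
  then show ?thesis
    by simp
qed

text \<open>As the level \<open>k\<close> grows, the lower bound for the probability of
  \<open>Xi z \<le> k\<close> tends to 1.\<close>

lemma Xi_finite:
  assumes "AE z in Q. summable (\<lambda>j. Fb (psum z j))"
  shows "AE z in Q. Xi z \<noteq> \<infinity>"
proof -
  let ?g = "\<lambda>k z. \<Sum>j. ennreal (Fb (real k + psum z j))"
  have "(\<lambda>k. 1 - (\<integral>\<^sup>+z. min 1 (?g k z) \<partial>Q)) \<longlonglongrightarrow> 1 - 0"
    by (intro tendsto_diff_ennreal tendsto_const expected_truncated_tail_sum_tendsto_0 assms) auto
  moreover have "1 - (\<integral>\<^sup>+z. min 1 (?g k z) \<partial>Q) \<le> emeasure Q {z. Xi z \<noteq> \<infinity>}" for k
  proof (rule order_trans[OF Xi_le_lower_bound])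
    show "emeasure Q {z. Xi z \<le> ereal (real k)} \<le> emeasure Q {z. Xi z \<noteq> \<infinity>}"
      by (intro emeasure_mono sets_QI) auto
  qed
  ultimately have "1 - 0 \<le> emeasure Q {z. Xi z \<noteq> \<infinity>}"
    by (intro LIMSEQ_le_const2) auto
  then have "P.prob {z. Xi z \<noteq> \<infinity>} = 1"
    using P.prob_le_1[of "{z. Xi z \<noteq> \<infinity>}"] by (simp add: P.emeasure_eq_measure)
  then show ?thesis
    by (simp add: Xi_finite_iff)
qed

lemma pred_summable_Fb [measurable]: "Measurable.pred seq_space (\<lambda>z. summable (\<lambda>j. Fb (y + psum z j)))"
  unfolding suminf_ennreal_less_top_iff[symmetric, OF Fb_nonneg] by measurable

text \<open>Where the series diverges, the exponential bound drives the products to 0, so only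
  sequences with a convergent series contribute to the limiting expectation.\<close>

lemma emeasure_Xi_le_summable:
  assumes "0 \<le> y"
  shows "emeasure Q {z. Xi z \<le> ereal y} \<le> emeasure Q {z. summable (\<lambda>j. Fb (y + psum z j))}"
proof -
  let ?f = "\<lambda>n z. ennreal (\<Prod>j<n. F (y + psum z j))"
  let ?G = "{z. summable (\<lambda>j. Fb (y + psum z j))}"
  have G: "?G \<in> sets Q"
    by (intro sets_QI) measurable
  have "emeasure Q {z. Xi z \<le> ereal y} = (INF n. \<integral>\<^sup>+z. ?f n z \<partial>Q)"
    using assms by (simp add: emeasure_Xi_le emeasure_below)
  also have "\<dots> = (\<integral>\<^sup>+z. (INF n. ?f n z) \<partial>Q)"
  proof (rule nn_integral_monotone_convergence_INF_decseq[symmetric])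
    show "decseq ?f"
      by (intro decseq_SucI le_funI ennreal_leI) (auto intro!: mult_right_le_one_le prod_nonneg F_nonneg F_le_1)
    show "(\<integral>\<^sup>+z. ?f 0 z \<partial>Q) < \<infinity>"
      using P.emeasure_space_1 by simp
  qed measurable
  also have "\<dots> \<le> (\<integral>\<^sup>+z. indicator ?G z \<partial>Q)"
  proof (rule nn_integral_mono)
    fix z
    show "(INF n. ?f n z) \<le> indicator ?G z"
    proof (cases "z \<in> ?G")
      case True
      then show ?thesis
        by (auto intro!: INF_lower2[of 0])
    next
      case False
      have small: "(INF n. ?f n z) \<le> ennreal e" if e: "0 < e" for e
      proof -
        \<comment> \<open>The threshold \<open>- ln e\<close> is what the exponential bound needs to
          fall below \<open>e\<close>.\<close>
        have "\<not> (\<forall>n. (\<Sum>j<n. Fb (y + psum z j)) \<le> - ln e)"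
          using False summableI_nonneg_bounded[of "\<lambda>j. Fb (y + psum z j)" "- ln e"] by auto
        then obtain n where n: "- ln e < (\<Sum>j<n. Fb (y + psum z j))"
          by (auto simp: not_le)
        have "(\<Prod>j<n. F (y + psum z j)) \<le> exp (- (\<Sum>j<n. Fb (y + psum z j)))"
          using prod_le_exp_minus_sum[of "\<lambda>j. Fb (y + psum z j)" n, OF Fb_le_1] by (simp add: Fb_def)
        also have "\<dots> \<le> exp (ln e)"
          using n by simp
        finally show ?thesis
          using e by (intro INF_lower2[of n]) (auto intro: ennreal_leI)
      qed
      have "(INF n. ?f n z) \<le> 0"
        by (rule ennreal_le_epsilon) (simp only: add_0_left small)
      then show ?thesis
        by simp
    qed
  qed
  also have "\<dots> = emeasure Q ?G"
    using G by simp
  finally show ?thesis .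
qed

text \<open>
  Finiteness of \<open>Xi\<close> only yields summability with a large shift \<open>y\<close>; the walk itself provides the shift
  once \<open>psum z m\<close> exceeds \<open>y\<close>.
\<close>

lemma AE_summable_Fb:
  assumes "AE z in Q. Xi z \<noteq> \<infinity>"
  shows "AE z in Q. summable (\<lambda>j. Fb (psum z j))"
proof -
  let ?G = "\<lambda>y. {z. summable (\<lambda>j. Fb (y + psum z j))}"
  have G[measurable]: "?G y \<in> sets Q" for y
    by (intro sets_QI) measurable
  \<comment> \<open>The two events on the left are independent once the second is read off the
    sequence shifted by \<open>m\<close>; together they give convergence at level 0 by
    comparison.\<close>
  have shifted: "P.prob {z. y \<le> psum z m} * P.prob (?G y) \<le> P.prob (?G 0)" for y m
  proof -
    have "emeasure Q {z. y \<le> psum z m} * emeasure Q (?G y)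
      = emeasure Q {z. y \<le> psum z m \<and> summable (\<lambda>j. Fb (y + psum (shift m z) j))}"
      by (intro emeasure_conj_shift[symmetric]) (measurable, simp add: psum_comb_seq)
    also have "\<dots> \<le> emeasure Q (?G 0)"
    proof (intro emeasure_mono G, clarsimp)
      fix z assume y: "y \<le> psum z m" and s: "summable (\<lambda>j. Fb (y + psum (shift m z) j))"
      have "summable (\<lambda>j. Fb (psum z (j + m)))"
      proof (rule summable_comparison_test[OF _ s], intro exI allI impI)
        fix j
        show "norm (Fb (psum z (j + m))) \<le> Fb (y + psum (shift m z) j)"
          using y by (simp add: add.commute[of j] psum_add Fb_antimono)
      qed
      then show "summable (\<lambda>j. Fb (psum z j))"
        by (simp add: summable_iff_shift[of "\<lambda>j. Fb (psum z j)"])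
    qed
    finally show ?thesis
      by (simp add: P.emeasure_eq_measure flip: ennreal_mult)
  qed
  \<comment> \<open>Let \<open>m\<close> tend to infinity, so that the first factor tends to
    1.\<close>
  have "1 * P.prob (?G y) \<le> P.prob (?G 0)" for y
    by (rule LIMSEQ_le_const2[OF tendsto_mult[OF prob_psum_ge[of y] tendsto_const]]) (use shifted in auto)
  moreover have "P.prob {z. Xi z \<le> ereal (real k)} \<le> P.prob (?G (real k))" for k
    using emeasure_Xi_le_summable[of "real k"] by (simp add: P.emeasure_eq_measure)
  ultimately have "P.prob {z. Xi z \<noteq> \<infinity>} \<le> P.prob (?G 0)"
    by (intro LIMSEQ_le_const2[OF prob_Xi_le]) (auto intro: order_trans)
  then have "P.prob (?G 0) = 1"
    using assms by (intro antisym[OF P.prob_le_1]) (simp add: Xi_finite_iff)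
  then show ?thesis
    using P.prob_Collect_eq_1[of "\<lambda>z. summable (\<lambda>j. Fb (0 + psum z j))"] G[of 0] by simp
qed

section \<open>The stationary law\<close>

text \<open>Since \<open>real_of_ereal\<close> sends infinity to 0, this is always a probability
  measure; it is the law of \<open>Xi\<close> itself when \<open>Xi\<close> is almost surely
  finite.\<close>

definition Xi_law :: "real measure" where
  "Xi_law = restrict_space (distr Q borel (\<lambda>z. real_of_ereal (Xi z))) {0..}"

lemma sets_Xi_law: "sets Xi_law = sets (restrict_space borel {0..})"
  unfolding Xi_law_def by (rule sets_restrict_space_cong) simp

lemma space_Xi_law: "space Xi_law = {0..}"
  by (simp add: Xi_law_def space_restrict_space)

lemma emeasure_Xi_law:
  assumes "B \<in> sets Xi_law"
  shows "emeasure Xi_law B = emeasure Q {z. real_of_ereal (Xi z) \<in> B}"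
proof -
  have "B \<in> sets borel" "B \<subseteq> {0..}"
    using assms unfolding sets_Xi_law by (auto simp: sets_restrict_space_iff)
  then show ?thesis
    unfolding Xi_law_def by (subst emeasure_restrict_space) (auto simp: emeasure_distr vimage_def)
qed

lemma real_of_Xi_nonneg: "0 \<le> real_of_ereal (Xi z)"
  by (simp add: real_of_ereal_pos Xi_nonneg)

lemma stationary_Xi_law:
  assumes fin: "AE z in Q. Xi z \<noteq> \<infinity>"
  shows "stationary_distribution {0..} law Xi_law"
  unfolding stationary_distribution_def
proof (intro conjI ballI sets_Xi_law)
  show "prob_space Xi_law"
  proof
    have "{0..} \<in> sets Xi_law"
      using sets.top[of Xi_law] by (simp add: space_Xi_law)
    then show "emeasure Xi_law (space Xi_law) = 1"
      using P.emeasure_space_1 by (simp add: space_Xi_law emeasure_Xi_law real_of_Xi_nonneg)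
  qed
next
  fix B assume B: "B \<in> sets Xi_law"
  then have B'[measurable]: "B \<in> sets borel"
    unfolding sets_Xi_law by (auto simp: sets_restrict_space_iff)
  interpret QQ: pair_prob_space Q Q ..
  define w where "w z = real_of_ereal (Xi z)" for z
  have [measurable]: "w \<in> borel_measurable seq_space"
    unfolding w_def[abs_def] by measurable
  have step: "w (case_nat p z) = max (w z - snd p) (fst p)" if z: "Xi z \<noteq> \<infinity>" and p: "0 < fst p" "0 < snd p" for p z
  proof -
    obtain x where "Xi z = ereal x"
      using z Xi_nonneg[of z] by (cases "Xi z") auto
    then show ?thesis
      using p Xi_case_nat[of z x "fst p" "snd p"] by (simp add: w_def del: ereal_max)
  qed
  have "emeasure Xi_law B = (\<integral>\<^sup>+z. indicator {z. w z \<in> B} z \<partial>Q)"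
    unfolding emeasure_Xi_law[OF B] w_def by (intro nn_integral_indicator[symmetric] sets_QI) measurable
  also have "\<dots> = (\<integral>\<^sup>+z. indicator B (w z) \<partial>Q)"
    by (intro nn_integral_cong) (simp add: indicator_def)
  \<comment> \<open>The sequence is split after one pair, which leaves \<open>v 0\<close> in front
    of an independent copy \<open>z\<close>.\<close>
  also have "\<dots> = (\<integral>\<^sup>+v. \<integral>\<^sup>+z. indicator B (w (case_nat (v 0) z)) \<partial>Q \<partial>Q)"
    by (subst nn_integral_comb_seq[of _ "Suc 0"]) auto
  also have "\<dots> = (\<integral>\<^sup>+v. \<integral>\<^sup>+z. indicator B (max (w z - snd (v 0)) (fst (v 0))) \<partial>Q \<partial>Q)"
  proof (rule nn_integral_cong_AE)
    show "AE v in Q. (\<integral>\<^sup>+z. indicator B (w (case_nat (v 0) z)) \<partial>Q)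
      = (\<integral>\<^sup>+z. indicator B (max (w z - snd (v 0)) (fst (v 0))) \<partial>Q)"
      using AE_positive_seq
    proof eventually_elim
      case (elim v)
      show ?case
        using fin by (intro nn_integral_cong_AE) (auto elim!: eventually_mono simp: step elim[unfolded positive_seq_def])
    qed
  qed
  also have "\<dots> = (\<integral>\<^sup>+z. \<integral>\<^sup>+v. indicator B (max (w z - snd (v 0)) (fst (v 0))) \<partial>Q \<partial>Q)"
    by (rule QQ.Fubini') measurable
  \<comment> \<open>The indicator equals 1 because \<open>w\<close> is nonnegative; it is inserted
    to fit the integral over the restricted space.\<close>
  also have "\<dots> = (\<integral>\<^sup>+z. transition law (w z) B * indicator {0..} (w z) \<partial>Q)"
    by (intro nn_integral_cong) (simp add: transition_law w_def real_of_Xi_nonneg)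
  also have "\<dots> = (\<integral>\<^sup>+x. transition law x B \<partial>Xi_law)"
    unfolding Xi_law_def w_def
    by (subst nn_integral_restrict_space) (simp_all add: nn_integral_distr)
  finally show "emeasure Xi_law B = (\<integral>\<^sup>+x. transition law x B \<partial>Xi_law)" .
qed

text \<open>At a level \<open>k\<close> with probability of \<open>Xi z \<le> k\<close> above 1/2,
  the chain from 0 is in \<open>[0, k]\<close> with probability at least 1/2 at every time, so the
  expected visits diverge.\<close>

lemma positive_harris_recurrent_law:
  assumes "AE z in Q. Xi z \<noteq> \<infinity>"
  shows "positive_harris_recurrent {0..} law"
proof -
  have "P.prob {z. Xi z \<noteq> \<infinity>} = 1"
    using assms by (simp add: Xi_finite_iff)
  then obtain k where k: "P.prob {z. Xi z \<le> ereal (real k)} > 1 / 2"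
    using order_tendstoD(1)[OF prob_Xi_le, of "1 / 2"] by (auto simp: eventually_sequentially)
  have "ennreal (1 / 2) \<le> emeasure Q {z. orbit 0 z n \<le> real k}" for n
  proof -
    have "ennreal (1 / 2) \<le> emeasure Q {z. Xi z \<le> ereal (real k)}"
      using k by (simp add: P.emeasure_eq_measure ennreal_leI del: ennreal_half)
    also have "\<dots> \<le> emeasure Q {z. below n (real k) z}"
      unfolding emeasure_Xi_le[OF of_nat_0_le_iff] by (rule INF_lower) simp
    finally show ?thesis
      by (simp add: emeasure_orbit_0_le)
  qed
  then have "(\<Sum>n. ennreal (1 / 2)) \<le> (\<Sum>n. emeasure Q {z. orbit 0 z n \<le> real k})"
    by (intro suminf_le) auto
  moreover have "(\<Sum>n::nat. ennreal (1 / 2)) = \<infinity>"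
    using suminf_ennreal_less_top_iff[of "\<lambda>n. 1 / 2"] by (auto simp: summable_const_iff less_top[symmetric])
  ultimately have "(\<Sum>n. emeasure Q {z. orbit 0 z n \<le> real k}) = \<infinity>"
    by (simp add: top_unique)
  then show ?thesis
    unfolding positive_harris_recurrent_def
    using harris_recurrent_law stationary_Xi_law[OF assms] by blast
qed

end

section \<open>From two iid sequences to one sequence of iid pairs\<close>

text \<open>It suffices to test on measurable rectangles, an intersection-stable generator. There
  the probability splits first between the two sequences and then within each of them.\<close>

lemma (in prob_space) indep_vars_Pair:
  assumes X: "indep_vars (\<lambda>_. A) X UNIV" and Y: "indep_vars (\<lambda>_. B) Y UNIV"
    and XY: "indep_var (\<Pi>\<^sub>M i\<in>UNIV. A) (\<lambda>\<omega> i. X i \<omega>) (\<Pi>\<^sub>M i\<in>UNIV. B) (\<lambda>\<omega> i. Y i \<omega>)"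
  shows "indep_vars (\<lambda>_. A \<Otimes>\<^sub>M B) (\<lambda>i \<omega>. (X i \<omega>, Y i \<omega>)) UNIV"
proof -
  let ?Z = "\<lambda>i \<omega>. (X i \<omega>, Y i \<omega>)"
  have rv[measurable]: "X i \<in> M \<rightarrow>\<^sub>M A" "Y i \<in> M \<rightarrow>\<^sub>M B" for i
    using X Y by (auto simp: indep_vars_def2)
  define G where "G i = {?Z i -` C \<inter> space M | C. C \<in> {a \<times> b | a b. a \<in> sets A \<and> b \<in> sets B}}" for i
  have G_eq: "{?Z i -` C \<inter> space M | C. C \<in> sets (A \<Otimes>\<^sub>M B)} = sigma_sets (space M) (G i)" for i
    unfolding G_def sets_pair_measure
    by (rule sigma_sets_vimage_commute) (auto intro: measurable_space[OF rv(1)] measurable_space[OF rv(2)])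
  have rect: "prob (\<Inter>i\<in>J. ?Z i -` (a i \<times> b i) \<inter> space M)
      = (\<Prod>i\<in>J. prob (X i -` a i \<inter> space M) * prob (Y i -` b i \<inter> space M))"
    if J: "finite J" "J \<noteq> {}" and a: "\<And>i. i \<in> J \<Longrightarrow> a i \<in> sets A" and b: "\<And>i. i \<in> J \<Longrightarrow> b i \<in> sets B" for J a b
  proof -
    let ?a = "prod_emb UNIV (\<lambda>_. A) J (Pi\<^sub>E J a)" and ?b = "prod_emb UNIV (\<lambda>_. B) J (Pi\<^sub>E J b)"
    have *: "(\<lambda>\<omega> i. X i \<omega>) -` ?a \<inter> space M = (\<Inter>i\<in>J. X i -` a i \<inter> space M)"
      "(\<lambda>\<omega> i. Y i \<omega>) -` ?b \<inter> space M = (\<Inter>i\<in>J. Y i -` b i \<inter> space M)"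
      "(\<lambda>\<omega>. (\<lambda>i. X i \<omega>, \<lambda>i. Y i \<omega>)) -` (?a \<times> ?b) \<inter> space M = (\<Inter>i\<in>J. ?Z i -` (a i \<times> b i) \<inter> space M)"
      using J measurable_space[of "X i" M A for i] measurable_space[of "Y i" M B for i]
      by (auto simp: prod_emb_def PiE_iff space_PiM)
    have "prob (\<Inter>i\<in>J. ?Z i -` (a i \<times> b i) \<inter> space M)
      = prob (\<Inter>i\<in>J. X i -` a i \<inter> space M) * prob (\<Inter>i\<in>J. Y i -` b i \<inter> space M)"
      using indep_varD[OF XY, of ?a ?b] J a b unfolding * by (simp add: sets_PiM_I)
    also have "\<dots> = (\<Prod>i\<in>J. prob (X i -` a i \<inter> space M)) * (\<Prod>i\<in>J. prob (Y i -` b i \<inter> space M))"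
      using J a b by (intro arg_cong2[where f = "(*)"] indep_varsD[OF X] indep_varsD[OF Y]) auto
    finally show ?thesis
      by (simp add: prod.distrib)
  qed
  have "indep_sets G UNIV"
  proof (rule indep_setsI)
    show "G i \<subseteq> events" for i
      unfolding G_def by (auto intro!: measurable_sets[of _ M "A \<Otimes>\<^sub>M B"])
  next
    fix E J assume J: "J \<noteq> {}" "finite (J :: 'b set)" and "\<forall>j\<in>J. E j \<in> G j"
    then have "\<forall>j\<in>J. \<exists>a b. E j = ?Z j -` (a \<times> b) \<inter> space M \<and> a \<in> sets A \<and> b \<in> sets B"
      unfolding G_def by blast
    then obtain a b where ab: "\<And>j. j \<in> J \<Longrightarrow> E j = ?Z j -` (a j \<times> b j) \<inter> space M"
      "\<And>j. j \<in> J \<Longrightarrow> a j \<in> sets A" "\<And>j. j \<in> J \<Longrightarrow> b j \<in> sets B"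
      by metis
    have "prob (\<Inter>j\<in>J. E j) = (\<Prod>j\<in>J. prob (X j -` a j \<inter> space M) * prob (Y j -` b j \<inter> space M))"
      using rect[OF J(2,1) ab(2,3)] ab(1) by simp
    also have "\<dots> = (\<Prod>j\<in>J. prob (E j))"
      using rect[of "{j}" a b for j] ab by (intro prod.cong) auto
    finally show "prob (\<Inter>j\<in>J. E j) = (\<Prod>j\<in>J. prob (E j))" .
  qed
  moreover have "Int_stable (G i)" for i
  proof (rule Int_stableI)
    fix C D assume "C \<in> G i" "D \<in> G i"
    then obtain a b a' b' where "C = ?Z i -` (a \<times> b) \<inter> space M" "D = ?Z i -` (a' \<times> b') \<inter> space M"
      "a \<in> sets A" "b \<in> sets B" "a' \<in> sets A" "b' \<in> sets B"
      unfolding G_def by blast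
    then have "C \<inter> D = ?Z i -` ((a \<inter> a') \<times> (b \<inter> b')) \<inter> space M" "a \<inter> a' \<in> sets A" "b \<inter> b' \<in> sets B"
      by auto
    then show "C \<inter> D \<in> G i"
      unfolding G_def by blast
  qed
  ultimately have "indep_sets (\<lambda>i. sigma_sets (space M) (G i)) UNIV"
    by (intro indep_sets_sigma) auto
  then show ?thesis
    unfolding indep_vars_def2 G_eq by simp
qed

text \<open>An arbitrary injection \<sigma> covers both the future indices \<open>1 + k\<close> and
  the past indices \<open>- 1 - k\<close>.\<close>

lemma distr_driving_pairs:
  fixes \<sigma> :: "nat \<Rightarrow> int"
  assumes M: "prob_space M" and s: "iid_sequence M s" and t: "iid_sequence M t"
    and st: "independent_sequences M s t" and \<sigma>: "inj \<sigma>"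
  shows "distr M seq_space (\<lambda>\<omega> k. (s (\<sigma> k) \<omega>, t (\<sigma> k) \<omega>))
    = (\<Pi>\<^sub>M i\<in>UNIV. distr M borel (s 1) \<Otimes>\<^sub>M distr M borel (t 1))"
proof -
  interpret prob_space M by fact
  let ?Z = "\<lambda>i \<omega>. (s i \<omega>, t i \<omega>)"
  let ?\<kappa> = "distr M borel (s 1) \<Otimes>\<^sub>M distr M borel (t 1)"
  have ind: "indep_vars (\<lambda>_. borel) s UNIV" "indep_vars (\<lambda>_. borel) t UNIV"
    and st': "indep_var (\<Pi>\<^sub>M i\<in>UNIV. borel) (\<lambda>\<omega> i. s i \<omega>) (\<Pi>\<^sub>M i\<in>UNIV. borel) (\<lambda>\<omega> i. t i \<omega>)"
    and same: "distr M borel (s i) = distr M borel (s 1)" "distr M borel (t i) = distr M borel (t 1)" for i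
    using s t st unfolding iid_sequence_def independent_sequences_def by blast+
  have [measurable]: "s i \<in> borel_measurable M" "t i \<in> borel_measurable M" for i
    using ind by (auto simp: indep_vars_def2)
  have law: "distr M (borel \<Otimes>\<^sub>M borel) (?Z i) = ?\<kappa>" for i
  proof -
    have "indep_var borel ((\<lambda>f. f i) \<circ> (\<lambda>\<omega> i. s i \<omega>)) borel ((\<lambda>f. f i) \<circ> (\<lambda>\<omega> i. t i \<omega>))"
      by (rule indep_var_compose[OF st']) measurable
    then show ?thesis
      unfolding indep_var_distribution_eq by (simp add: comp_def same[of i])
  qed
  have all: "distr M (\<Pi>\<^sub>M i\<in>UNIV. borel \<Otimes>\<^sub>M borel) (\<lambda>\<omega> i. ?Z i \<omega>) = (\<Pi>\<^sub>M i\<in>(UNIV :: int set). ?\<kappa>)"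
    using indep_vars_Pair[OF ind st'] by (subst (asm) indep_vars_iff_distr_eq_PiM') (simp_all add: law restrict_UNIV)
  have "distr M seq_space (\<lambda>\<omega> k. ?Z (\<sigma> k) \<omega>)
    = distr (distr M (\<Pi>\<^sub>M i\<in>UNIV. borel \<Otimes>\<^sub>M borel) (\<lambda>\<omega> i. ?Z i \<omega>)) seq_space (\<lambda>f k. f (\<sigma> k))"
    by (subst distr_distr) (auto simp: comp_def intro!: measurable_PiM_single' simp: space_pair_measure)
  also have "\<dots> = distr (\<Pi>\<^sub>M i\<in>(UNIV :: int set). ?\<kappa>) (\<Pi>\<^sub>M i\<in>UNIV. ?\<kappa>) (\<lambda>f k. f (\<sigma> k))"
    unfolding all by (rule distr_cong) (auto intro!: sets_PiM_cong sets_pair_measure_cong)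
  also have "\<dots> = (\<Pi>\<^sub>M i\<in>UNIV. ?\<kappa>)"
  proof -
    interpret S: prob_space "distr M borel (s 1)" by (rule prob_space_distr) simp
    interpret T: prob_space "distr M borel (t 1)" by (rule prob_space_distr) simp
    interpret ST: pair_prob_space "distr M borel (s 1)" "distr M borel (t 1)" ..
    show ?thesis
      using distr_PiM_reindex[of UNIV "\<lambda>_. ?\<kappa>" \<sigma> UNIV] \<sigma> by (simp add: restrict_UNIV ST.prob_space_axioms)
  qed
  finally show ?thesis .
qed

section \<open>Criteria in terms of the expected products\<close>

context driving_laws begin

lemma finite_expected_visits:
  assumes "(\<Sum>n. \<integral>\<^sup>+z. ennreal (\<Prod>i=1..Suc n. F (y + psum z i)) \<partial>Q) < \<infinity>"
  shows "(\<integral>\<^sup>+\<xi>. (\<Sum>n. indicator {..y} (\<xi> n)) \<partial>law x) < \<infinity>"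
proof -
  let ?q = "\<lambda>n. emeasure Q {z. orbit x z n \<le> y}"
  have "(\<integral>\<^sup>+\<xi>. (\<Sum>n. indicator {..y} (\<xi> n)) \<partial>law x) = (\<Sum>n. \<integral>\<^sup>+\<xi>. indicator {..y} (\<xi> n) \<partial>law x)"
    by (rule nn_integral_suminf) measurable
  also have "\<dots> = (\<Sum>n. ?q n)"
  proof (rule suminf_cong)
    fix n
    have "(\<integral>\<^sup>+\<xi>. indicator {..y} (\<xi> n) \<partial>law x) = (\<integral>\<^sup>+\<xi>. indicator {\<xi>. \<xi> n \<le> y} \<xi> \<partial>law x)"
      by (intro nn_integral_cong) (simp add: indicator_def)
    also have "\<dots> = emeasure (law x) {\<xi>. \<xi> n \<le> y}"
    proof (rule nn_integral_indicator)
      have "{\<xi> \<in> space (law x). \<xi> n \<le> y} \<in> sets (law x)"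
        by measurable
      then show "{\<xi>. \<xi> n \<le> y} \<in> sets (law x)"
        by simp
    qed
    finally show "(\<integral>\<^sup>+\<xi>. indicator {..y} (\<xi> n) \<partial>law x) = ?q n"
      by (simp add: emeasure_law)
  qed
  \<comment> \<open>At time \<open>n + 2\<close> the bound has the factors 0 to
    \<open>n + 1\<close>; dropping factor 0 leaves the given product. The two skipped terms are
    finite.\<close>
  also have "\<dots> = (\<Sum>n. ?q (n + 2)) + (\<Sum>n<2. ?q n)"
    by (rule suminf_offset) simp
  also have "\<dots> < \<infinity>"
  proof -
    have "?q (n + 2) \<le> (\<integral>\<^sup>+z. ennreal (\<Prod>i=1..Suc n. F (y + psum z i)) \<partial>Q)" for n
    proof -
      have "?q (n + 2) \<le> (\<integral>\<^sup>+z. ennreal (\<Prod>j<Suc (Suc n). F (y + psum z j)) \<partial>Q)"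
        using emeasure_orbit_le_below[of x "n + 2" y] by (simp add: emeasure_below)
      also have "\<dots> \<le> (\<integral>\<^sup>+z. ennreal (\<Prod>i=1..Suc n. F (y + psum z i)) \<partial>Q)"
        unfolding prod.lessThan_Suc_shift[of _ "Suc n"] One_nat_def prod.atLeast1_atMost_eq
        by (intro nn_integral_mono ennreal_leI)
           (simp add: mult_left_le_one_le prod_nonneg F_nonneg F_le_1 del: prod.lessThan_Suc)
      finally show ?thesis .
    qed
    then have "(\<Sum>n. ?q (n + 2)) \<le> (\<Sum>n. \<integral>\<^sup>+z. ennreal (\<Prod>i=1..Suc n. F (y + psum z i)) \<partial>Q)"
      by (intro suminf_le) auto
    then have "(\<Sum>n. ?q (n + 2)) < \<infinity>"
      using assms by (rule le_less_trans)
    then show ?thesis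
      by (simp add: P.emeasure_eq_measure)
  qed
  finally show ?thesis .
qed

lemma harris_recurrent_of_products:
  assumes y: "0 \<le> y"
    and div: "(\<Sum>n. \<integral>\<^sup>+z. ennreal (\<Prod>i=0..<Suc n. F (y + psum z i)) \<partial>Q) = \<infinity>"
  shows "harris_recurrent {0..} law"
proof (rule harris_recurrent_law)
  let ?q = "\<lambda>n. emeasure Q {z. orbit 0 z n \<le> y}"
  \<comment> \<open>The series of products starts with one factor, that is at time 1; only the
    finite term at time 0 is missing.\<close>
  have "?q (n + 1) = (\<integral>\<^sup>+z. ennreal (\<Prod>i=0..<Suc n. F (y + psum z i)) \<partial>Q)" for n
    by (simp only: atLeast0LessThan emeasure_below[symmetric] emeasure_orbit_0_le[OF y] Suc_eq_plus1)
  then have "(\<Sum>n. ?q (n + 1)) = \<infinity>"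
    using div by simp
  moreover have "(\<Sum>n. ?q n) = (\<Sum>n. ?q (n + 1)) + (\<Sum>n<1. ?q n)"
    by (rule suminf_offset) simp
  ultimately show "(\<Sum>n. ?q n) = \<infinity>"
    by simp
qed

end

section \<open>Transfer to the given sequences\<close>

lemma chain_eq_orbit: "chain s t x n \<omega> = orbit x (\<lambda>k. (s (1 + int k) \<omega>, t (1 + int k) \<omega>)) n"
  by (induction n) simp_all

lemma bwd_sum_eq_psum: "bwd_sum t n \<omega> = psum (\<lambda>k. (s (- 1 - int k) \<omega>, t (- 1 - int k) \<omega>)) n"
  by (simp add: bwd_sum_def psum_def sum.atLeast1_atMost_eq algebra_simps)

lemma X_inf_eq_Xi: "X_inf s t \<omega> = Xi (\<lambda>k. (s (- 1 - int k) \<omega>, t (- 1 - int k) \<omega>))"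
proof -
  have "{1..} = range Suc"
    by (auto simp: image_iff dest: Suc_le_D)
  then show ?thesis
    by (simp add: X_inf_def Xi_def image_image bwd_sum_eq_psum[of t _ \<omega> s] algebra_simps)
qed

theorem theorem2:
  fixes M :: "'a measure" and s t :: "int \<Rightarrow> 'a \<Rightarrow> real"
    and m\<^sub>0 :: nat and w\<^sub>0 :: real
  assumes "prob_space M"
    and "iid_sequence M s" and "iid_sequence M t" and "independent_sequences M s t"
    and "\<And>n. AE \<omega> in M. s n \<omega> > 0" and "\<And>n. AE \<omega> in M. t n \<omega> > 0"
    and "m\<^sub>0 \<ge> 1"
    and "\<P>(\<omega> in M. s 1 \<omega> \<le> w\<^sub>0) \<ge> 1 / 2"
    and "\<P>(\<omega> in M. fwd_sum t m\<^sub>0 \<omega> > w\<^sub>0) \<ge> 1 / 2"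
  shows
    "(\<forall>y\<ge>0. (\<Sum>n. \<integral>\<^sup>+\<omega>. ennreal (\<Prod>i=1..Suc n. F_dist M s (y + bwd_sum t i \<omega>)) \<partial>M) < \<infinity> \<longrightarrow>
       (\<forall>x\<ge>0. (\<integral>\<^sup>+\<xi>. (\<Sum>n. indicator {..y} (\<xi> n)) \<partial>chain_law M s t x) < \<infinity>)) \<and>
     ((\<Sum>n. \<integral>\<^sup>+\<omega>. ennreal (\<Prod>i=0..<Suc n. F_dist M s (w\<^sub>0 + bwd_sum t i \<omega>)) \<partial>M) = \<infinity> \<longrightarrow>
       harris_recurrent {0..} (chain_law M s t)) \<and>
     (\<P>(\<omega> in M. (\<Sum>i. ennreal (F_tail M s (bwd_sum t (Suc i) \<omega>))) < \<infinity>) = 1 \<longleftrightarrow>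
       positive_harris_recurrent {0..} (chain_law M s t) \<and>
       (\<exists>\<pi>. stationary_distribution {0..} (chain_law M s t) \<pi> \<and>
         (\<forall>B\<in>sets \<pi>. emeasure \<pi> B = emeasure M {\<omega> \<in> space M. X_inf s t \<omega> \<in> ereal ` B})))"
proof -
  interpret M: prob_space M by fact
  define \<mu> where "\<mu> = distr M borel (s 1)"
  define \<nu> where "\<nu> = distr M borel (t 1)"
  have rv[measurable]: "s i \<in> borel_measurable M" "t i \<in> borel_measurable M" for i
    using assms(2,3) by (auto simp: iid_sequence_def M.indep_vars_def2)
  interpret driving_laws \<mu> \<nu>
  proof (unfold driving_laws_def driving_laws_axioms_def, intro conjI)
    show "prob_space \<mu>" "prob_space \<nu>"
      unfolding \<mu>_def \<nu>_def by (auto intro: M.prob_space_distr)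
    show "sets \<mu> = sets borel" "sets \<nu> = sets borel"
      by (simp_all add: \<mu>_def \<nu>_def)
    show "AE a in \<mu>. 0 < a"
      using assms(5)[of 1] unfolding \<mu>_def by (subst AE_distr_iff) auto
    show "AE b in \<nu>. 0 < b"
      using assms(6)[of 1] unfolding \<nu>_def by (subst AE_distr_iff) auto
  qed
  define fwd where "fwd \<omega> = (\<lambda>k. (s (1 + int k) \<omega>, t (1 + int k) \<omega>))" for \<omega>
  define bwd where "bwd \<omega> = (\<lambda>k. (s (- 1 - int k) \<omega>, t (- 1 - int k) \<omega>))" for \<omega>
  have [measurable]: "fwd \<in> M \<rightarrow>\<^sub>M seq_space" "bwd \<in> M \<rightarrow>\<^sub>M seq_space"
    unfolding fwd_def[abs_def] bwd_def[abs_def]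
    by (rule measurable_PiM_single'; simp add: space_pair_measure)+
  \<comment> \<open>Future and past pairs have the same law \<open>Q\<close>: the chain is read off
    the former, \<open>X_inf\<close> and \<open>bwd_sum\<close> off the latter.\<close>
  have fwd: "distr M seq_space fwd = Q" and bwd: "distr M seq_space bwd = Q"
    unfolding fwd_def[abs_def] bwd_def[abs_def] \<mu>_def \<nu>_def
    by (rule distr_driving_pairs[OF assms(1-4)]; simp add: inj_on_def)+
  have nn_integral_bwd: "(\<integral>\<^sup>+\<omega>. f (bwd \<omega>) \<partial>M) = (\<integral>\<^sup>+z. f z \<partial>Q)"
    if "f \<in> borel_measurable seq_space" for f
    unfolding bwd[symmetric] using that by (simp add: nn_integral_distr)
  have AE_bwd: "(AE \<omega> in M. R (bwd \<omega>)) \<longleftrightarrow> (AE z in Q. R z)"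
    if [measurable]: "Measurable.pred seq_space R" for R
    unfolding bwd[symmetric] by (subst AE_distr_iff) measurable
  have chain_law: "chain_law M s t = law"
  proof
    fix x
    have "chain_law M s t x = distr M path_space (orbit x \<circ> fwd)"
      unfolding chain_law_def by (simp add: comp_def chain_eq_orbit fwd_def)
    also have "\<dots> = distr (distr M seq_space fwd) path_space (orbit x)"
      by (rule distr_distr[symmetric]) measurable
    finally show "chain_law M s t x = law x"
      by (simp add: fwd law_def)
  qed
  have F_dist: "F_dist M s = F"
  proof
    fix x
    show "F_dist M s x = F x"
      unfolding F_dist_def F_def unfolding \<mu>_def by (subst measure_distr) (auto intro!: arg_cong[where f=M.prob])
  qed
  have F_tail: "F_tail M s = Fb"
  proof
    fix x
    have "F_tail M s x = 1 - F_dist M s x"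
      unfolding F_tail_def F_dist_def
      by (subst M.prob_neg[symmetric]) (simp_all add: not_le)
    then show "F_tail M s x = Fb x"
      by (simp add: Fb_def F_dist)
  qed
  have bwd_sum: "bwd_sum t n \<omega> = psum (bwd \<omega>) n" for n \<omega>
    by (simp add: bwd_def bwd_sum_eq_psum[of t n \<omega> s])
  have X_inf: "X_inf s t \<omega> = Xi (bwd \<omega>)" for \<omega>
    by (simp add: bwd_def X_inf_eq_Xi)
  \<comment> \<open>A negative level would have probability 0 under the law of the positive variable
    \<open>s 1\<close>.\<close>
  have w\<^sub>0: "0 \<le> w\<^sub>0"
  proof (rule ccontr)
    assume "\<not> 0 \<le> w\<^sub>0"
    then have "AE \<omega> in M. \<not> s 1 \<omega> \<le> w\<^sub>0"
      using assms(5)[of 1] by (auto elim!: eventually_mono)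
    then have "\<P>(\<omega> in M. s 1 \<omega> \<le> w\<^sub>0) = 0"
      by (subst M.prob_Collect_eq_0) auto
    with assms(8) show False
      by simp
  qed
  have tail: "\<P>(\<omega> in M. (\<Sum>i. ennreal (F_tail M s (bwd_sum t (Suc i) \<omega>))) < \<infinity>) = 1
    \<longleftrightarrow> (AE z in Q. summable (\<lambda>j. Fb (psum z j)))"
  proof -
    \<comment> \<open>This series starts at the first partial sum and the other one at
      \<open>psum\<close> of 0; one term does not affect summability.\<close>
    have "(\<Sum>i. ennreal (F_tail M s (bwd_sum t (Suc i) \<omega>))) < \<infinity> \<longleftrightarrow> summable (\<lambda>j. Fb (psum (bwd \<omega>) j))" for \<omega>
      unfolding F_tail bwd_sum
      by (subst suminf_ennreal_less_top_iff) (simp_all add: summable_Suc_iff[of "\<lambda>j. Fb (psum (bwd \<omega>) j)"])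
    moreover have pred[measurable]: "Measurable.pred seq_space (\<lambda>z. summable (\<lambda>j. Fb (psum z j)))"
      using pred_summable_Fb[of 0] by simp
    ultimately show ?thesis
      using AE_bwd[OF pred] by (subst M.prob_Collect_eq_1) simp_all
  qed
  have c: "(AE z in Q. summable (\<lambda>j. Fb (psum z j))) \<longleftrightarrow> positive_harris_recurrent {0..} law \<and>
    (\<exists>\<pi>. stationary_distribution {0..} law \<pi> \<and>
      (\<forall>B\<in>sets \<pi>. emeasure \<pi> B = emeasure M {\<omega> \<in> space M. X_inf s t \<omega> \<in> ereal ` B}))"
    (is "_ \<longleftrightarrow> _ \<and> ?stat")
  proof (intro iffI conjI)
    assume "AE z in Q. summable (\<lambda>j. Fb (psum z j))"
    then have fin: "AE z in Q. Xi z \<noteq> \<infinity>"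
      by (rule Xi_finite)
    then show "positive_harris_recurrent {0..} law"
      by (rule positive_harris_recurrent_law)
    have "emeasure Xi_law B = emeasure M {\<omega> \<in> space M. X_inf s t \<omega> \<in> ereal ` B}" if B: "B \<in> sets Xi_law" for B
    proof -
      have [measurable]: "B \<in> sets borel"
        using B unfolding sets_Xi_law by (auto simp: sets_restrict_space_iff)
      \<comment> \<open>The image under \<open>ereal\<close> omits infinity, whereas
        \<open>real_of_ereal\<close> maps infinity to 0; hence the extra conjunct.\<close>
      have img: "X_inf s t \<omega> \<in> ereal ` B \<longleftrightarrow> Xi (bwd \<omega>) \<noteq> \<infinity> \<and> real_of_ereal (Xi (bwd \<omega>)) \<in> B" for \<omega>
        unfolding X_inf using Xi_nonneg[of "bwd \<omega>"] by (cases "Xi (bwd \<omega>)") auto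
      have "{z. real_of_ereal (Xi z) \<in> B} \<in> sets Q"
        by (intro sets_QI) measurable
      then have "emeasure Xi_law B = emeasure M {\<omega> \<in> space M. real_of_ereal (Xi (bwd \<omega>)) \<in> B}"
        unfolding emeasure_Xi_law[OF B] bwd[symmetric]
        by (subst emeasure_distr) (auto intro!: arg_cong[where f="emeasure M"])
      also have "\<dots> = emeasure M {\<omega> \<in> space M. X_inf s t \<omega> \<in> ereal ` B}"
        unfolding img
      proof (rule emeasure_eq_AE)
        have "AE \<omega> in M. Xi (bwd \<omega>) \<noteq> \<infinity>"
          using fin by (subst AE_bwd) auto
        then show "AE \<omega> in M. \<omega> \<in> {\<omega> \<in> space M. real_of_ereal (Xi (bwd \<omega>)) \<in> B} \<longleftrightarrow>
            \<omega> \<in> {\<omega> \<in> space M. Xi (bwd \<omega>) \<noteq> \<infinity> \<and> real_of_ereal (Xi (bwd \<omega>)) \<in> B}"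
          by eventually_elim simp
      qed measurable
      finally show ?thesis .
    qed
    then show ?stat
      using stationary_Xi_law[OF fin] by blast
  next
    assume "positive_harris_recurrent {0..} law \<and> ?stat"
    then obtain \<pi> where \<pi>: "stationary_distribution {0..} law \<pi>"
      "\<And>B. B \<in> sets \<pi> \<Longrightarrow> emeasure \<pi> B = emeasure M {\<omega> \<in> space M. X_inf s t \<omega> \<in> ereal ` B}"
      by blast
    then interpret \<pi>: prob_space \<pi>
      by (simp add: stationary_distribution_def)
    have "space \<pi> = {0..}"
      using \<pi>(1) sets_eq_imp_space_eq[of \<pi> "restrict_space borel {0..}"]
      by (simp add: stationary_distribution_def space_restrict_space)
    \<comment> \<open>The total mass 1 of \<pi> says exactly that \<open>X_inf\<close> is almost
      surely finite.\<close>
    then have "emeasure M {\<omega> \<in> space M. X_inf s t \<omega> \<in> ereal ` {0..}} = 1"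
      using \<pi>(2)[OF sets.top] \<pi>.emeasure_space_1 by simp
    also have "{\<omega> \<in> space M. X_inf s t \<omega> \<in> ereal ` {0..}} = {\<omega> \<in> space M. Xi (bwd \<omega>) \<noteq> \<infinity>}"
    proof -
      have "X_inf s t \<omega> \<in> ereal ` {0..} \<longleftrightarrow> Xi (bwd \<omega>) \<noteq> \<infinity>" for \<omega>
        unfolding X_inf using Xi_nonneg[of "bwd \<omega>"] by (cases "Xi (bwd \<omega>)") auto
      then show ?thesis
        by simp
    qed
    finally have "M.prob {\<omega> \<in> space M. Xi (bwd \<omega>) \<noteq> \<infinity>} = 1"
      by (simp add: M.emeasure_eq_measure)
    then have "AE \<omega> in M. Xi (bwd \<omega>) \<noteq> \<infinity>"
      by (subst (asm) M.prob_Collect_eq_1) measurable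
    then have "AE z in Q. Xi z \<noteq> \<infinity>"
      by (subst (asm) AE_bwd) measurable
    then show "AE z in Q. summable (\<lambda>j. Fb (psum z j))"
      by (rule AE_summable_Fb)
  qed
  have a: "(\<integral>\<^sup>+\<xi>. (\<Sum>n. indicator {..y} (\<xi> n)) \<partial>law x) < \<infinity>"
    if "(\<Sum>n. \<integral>\<^sup>+\<omega>. ennreal (\<Prod>i=1..Suc n. F (y + psum (bwd \<omega>) i)) \<partial>M) < \<infinity>" for x y
  proof (rule finite_expected_visits)
    have "(\<integral>\<^sup>+\<omega>. ennreal (\<Prod>i=1..Suc n. F (y + psum (bwd \<omega>) i)) \<partial>M)
      = (\<integral>\<^sup>+z. ennreal (\<Prod>i=1..Suc n. F (y + psum z i)) \<partial>Q)" for n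
      by (rule nn_integral_bwd) measurable
    with that show "(\<Sum>n. \<integral>\<^sup>+z. ennreal (\<Prod>i=1..Suc n. F (y + psum z i)) \<partial>Q) < \<infinity>"
      by (simp only:)
  qed
  have b: "harris_recurrent {0..} law"
    if "(\<Sum>n. \<integral>\<^sup>+\<omega>. ennreal (\<Prod>i=0..<Suc n. F (w\<^sub>0 + psum (bwd \<omega>) i)) \<partial>M) = \<infinity>"
  proof (rule harris_recurrent_of_products[OF w\<^sub>0])
    have "(\<integral>\<^sup>+\<omega>. ennreal (\<Prod>i=0..<Suc n. F (w\<^sub>0 + psum (bwd \<omega>) i)) \<partial>M)
      = (\<integral>\<^sup>+z. ennreal (\<Prod>i=0..<Suc n. F (w\<^sub>0 + psum z i)) \<partial>Q)" for n
      by (rule nn_integral_bwd) measurable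
    with that show "(\<Sum>n. \<integral>\<^sup>+z. ennreal (\<Prod>i=0..<Suc n. F (w\<^sub>0 + psum z i)) \<partial>Q) = \<infinity>"
      by (simp only:)
  qed
  show ?thesis
    unfolding tail unfolding chain_law F_dist bwd_sum
  proof (intro conjI allI impI)
    fix y x
    assume "(\<Sum>n. \<integral>\<^sup>+\<omega>. ennreal (\<Prod>i=1..Suc n. F (y + psum (bwd \<omega>) i)) \<partial>M) < \<infinity>"
    then show "(\<integral>\<^sup>+\<xi>. (\<Sum>n. indicator {..y} (\<xi> n)) \<partial>law x) < \<infinity>"
      by (rule a)
  next
    assume "(\<Sum>n. \<integral>\<^sup>+\<omega>. ennreal (\<Prod>i=0..<Suc n. F (w\<^sub>0 + psum (bwd \<omega>) i)) \<partial>M) = \<infinity>"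
    then show "harris_recurrent {0..} law"
      by (rule b)
  qed (rule c)
qed

end
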